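(* Fix $b>0$ and $\underline{\pi}\in(0,1/2)$, and let $\mathcal{F}=\mathcal{M}_1\cup\mathcal{M}_2$, $\mathscr{R}_n^*$ and the AIC-like estimator $\hat f_n^{\mathrm{AIC}}$ (depending on $a>0$) be as defined in the context. For each sufficiently large $a>0$, there exist constants $0<c<C<\infty$ depending on $a$, $b$ and $\underline{\pi}$ such that, for all sufficiently large $n$, $$\frac{c}{n}\le\mathscr{R}_n^*\le\sup_{f_0\in\mathcal{F}}\mathrm{E}_{f_0}\big\{\mathfrak{h}^2(\hat f_n^{\mathrm{AIC}},f_0)\big\}\le\frac{C}{n}.$$
   Context: $\phi(x;\mu)=(2\pi)^{-1/2}\exp\{-(x-\mu)^2/2\}$ is the density of $\mathrm{N}(\mu,1)$ on $\mathbb{R}$ (with respect to Lebesgue measure). $\mathcal{M}_1=\{\phi(\cdot;\mu):\mu\in[-b,b]\}$ and $$\mathcal{M}_2=\{\pi\phi(\cdot;\mu_1)+(1-\pi)\phi(\cdot;\mu_2):\pi\in[\underline{\pi},1-\underline{\pi}],\ \mu_1,\mu_2\in[-b,b],\ \mu_1\le\mu_2\}.$$ $X_1,\dots,X_n$ are IID with Lebesgue density $f_0\in\mathcal{F}$; $\mathrm{E}_{f_0}$ denotes expectation under this law. $\ell_n(f)=-n^{-1}\sum_{i=1}^n\log f(X_i)$, and for $k\in\{1,2\}$, $\hat f_{k,n}\in\arg\min_{f\in\mathcal{M}_k}\ell_n(f)$ is a maximum likelihood estimator over $\mathcal{M}_k$. With $d_1=1$ and $d_2=3$, set $\mathrm{pen}_{k,n}^{\mathrm{AIC}}=a\,d_k/n$,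 $$\hat k_n^{\mathrm{AIC}}=\min\ \underset{k\in\{1,2\}}{\arg\min}\{\ell_n(\hat f_{k,n})+\mathrm{pen}_{k,n}^{\mathrm{AIC}}\},\qquad \hat f_n^{\mathrm{AIC}}=\hat f_{\hat k_n^{\mathrm{AIC}},n}.$$ Hellinger divergence: $\mathfrak{h}(f,g)=\{\frac12\int(f^{1/2}-g^{1/2})^2\,\mathrm{d}x\}^{1/2}$. Minimax risk: $\mathscr{R}_n^*=\inf_{\tilde f_n}\sup_{f_0\in\mathcal{F}}\mathrm{E}_{f_0}\{\mathfrak{h}^2(\tilde f_n,f_0)\}$, the infimum being over all measurable estimators $\tilde f_n$ based on $X_1,\dots,X_n$. All random quantities of interest are assumed measurable. *)

theory Defs
  imports "HOL-Probability.Probability"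
begin

definition model1 :: "real \<Rightarrow> (real \<Rightarrow> real) set" where
  "model1 b = {normal_density \<mu> 1 | \<mu>. \<mu> \<in> {-b..b}}"

definition model2 :: "real \<Rightarrow> real \<Rightarrow> (real \<Rightarrow> real) set" where
  "model2 b p = {\<lambda>t. w * normal_density \<mu>\<^sub>1 1 t + (1 - w) * normal_density \<mu>\<^sub>2 1 t | w \<mu>\<^sub>1 \<mu>\<^sub>2.
     w \<in> {p..1 - p} \<and> \<mu>\<^sub>1 \<in> {-b..b} \<and> \<mu>\<^sub>2 \<in> {-b..b} \<and> \<mu>\<^sub>1 \<le> \<mu>\<^sub>2}"

text \<open>The model index \<open>k\<close> is only ever used with values in \<open>{1, 2}\<close>.\<close>

definition model :: "real \<Rightarrow> real \<Rightarrow> nat \<Rightarrow> (real \<Rightarrow> real) set" where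
  "model b p k = (if k = 1 then model1 b else model2 b p)"

definition model_dim :: "nat \<Rightarrow> nat" where
  "model_dim k = (if k = 1 then 1 else 3)"

definition full_model :: "real \<Rightarrow> real \<Rightarrow> (real \<Rightarrow> real) set" where
  "full_model b p = model1 b \<union> model2 b p"

definition hellinger :: "(real \<Rightarrow> real) \<Rightarrow> (real \<Rightarrow> real) \<Rightarrow> real" where
  "hellinger f g = sqrt (1 / 2 * (\<integral>t. (sqrt (f t) - sqrt (g t))\<^sup>2 \<partial>lborel))"

definition prob_density :: "(real \<Rightarrow> real) \<Rightarrow> bool" where
  "prob_density f \<longleftrightarrow>
     f \<in> borel_measurable borel \<and> (\<forall>t. 0 \<le> f t) \<and> (\<integral>\<^sup>+t. ennreal (f t) \<partial>lborel) = 1"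

text \<open>
  A sample \<open>X\<^sub>1, \<dots>, X\<^sub>n\<close> is a point of the product space over the index set \<open>{1..n}\<close>, and an
  estimator is a map from samples to densities. Measurability of an estimator is joint
  measurability in the sample and the argument of the density; this makes its Hellinger
  divergence from a fixed density, and its log-likelihood, measurable functions of the sample.
\<close>

type_synonym sample = "nat \<Rightarrow> real"

definition sample_space :: "nat \<Rightarrow> sample measure" where
  "sample_space n = Pi\<^sub>M {1..n} (\<lambda>_. borel)"

definition sample_law :: "nat \<Rightarrow> (real \<Rightarrow> real) \<Rightarrow> sample measure" where
  "sample_law n f\<^sub>0 = Pi\<^sub>M {1..n} (\<lambda>_. density lborel (\<lambda>t. ennreal (f\<^sub>0 t)))"

definition estimator :: "nat \<Rightarrow> (sample \<Rightarrow> real \<Rightarrow> real) \<Rightarrow> bool" where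
  "estimator n est \<longleftrightarrow>
     (\<lambda>(x, t). est x t) \<in> borel_measurable (sample_space n \<Otimes>\<^sub>M borel) \<and>
     (\<forall>x \<in> space (sample_space n). prob_density (est x))"

definition risk :: "nat \<Rightarrow> (sample \<Rightarrow> real \<Rightarrow> real) \<Rightarrow> (real \<Rightarrow> real) \<Rightarrow> ennreal" where
  "risk n est f\<^sub>0 = (\<integral>\<^sup>+x. ennreal ((hellinger (est x) f\<^sub>0)\<^sup>2) \<partial>sample_law n f\<^sub>0)"

definition max_risk :: "real \<Rightarrow> real \<Rightarrow> nat \<Rightarrow> (sample \<Rightarrow> real \<Rightarrow> real) \<Rightarrow> ennreal" where
  "max_risk b p n est = (SUP f\<^sub>0 \<in> full_model b p. risk n est f\<^sub>0)"

definition minimax_risk :: "real \<Rightarrow> real \<Rightarrow> nat \<Rightarrow> ennreal" where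
  "minimax_risk b p n = (INF est \<in> {est. estimator n est}. max_risk b p n est)"

definition neg_loglik :: "nat \<Rightarrow> sample \<Rightarrow> (real \<Rightarrow> real) \<Rightarrow> real" where
  "neg_loglik n x f = - (1 / real n) * (\<Sum>i = 1..n. ln (f (x i)))"

definition is_mle :: "real \<Rightarrow> real \<Rightarrow> nat \<Rightarrow> nat \<Rightarrow> (sample \<Rightarrow> real \<Rightarrow> real) \<Rightarrow> bool" where
  "is_mle b p n k est \<longleftrightarrow>
     (\<lambda>(x, t). est x t) \<in> borel_measurable (sample_space n \<Otimes>\<^sub>M borel) \<and>
     (\<forall>x \<in> space (sample_space n). is_arg_min (neg_loglik n x) (\<lambda>f. f \<in> model b p k) (est x))"

definition aic_criterion ::
  "real \<Rightarrow> nat \<Rightarrow> (nat \<Rightarrow> sample \<Rightarrow> real \<Rightarrow> real) \<Rightarrow> sample \<Rightarrow> nat \<Rightarrow> real" where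
  "aic_criterion a n fhat x k = neg_loglik n x (fhat k x) + a * real (model_dim k) / real n"

definition aic_index ::
  "real \<Rightarrow> nat \<Rightarrow> (nat \<Rightarrow> sample \<Rightarrow> real \<Rightarrow> real) \<Rightarrow> sample \<Rightarrow> nat" where
  "aic_index a n fhat x = Min {k. is_arg_min (aic_criterion a n fhat x) (\<lambda>j. j \<in> {1, 2}) k}"

definition aic_estimator ::
  "real \<Rightarrow> nat \<Rightarrow> (nat \<Rightarrow> sample \<Rightarrow> real \<Rightarrow> real) \<Rightarrow> sample \<Rightarrow> real \<Rightarrow> real" where
  "aic_estimator a n fhat x = fhat (aic_index a n fhat x) x"

end

theory Submission
  imports Defs
begin

text \<open>
  Upper bound. Every density in the model is a Gaussian location mixture with a two-point mixing
  law, and the estimator maximises the likelihood over the model up to a factor \<open>exp (3 * a)\<close>.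
  Writing \<open>s = sqrt (f / f\<^sub>0)\<close>, the inequality \<open>ln s \<le> s - 1\<close> and \<open>E s = 1 - h\<^sup>2\<close> turn this into
  \<open>n h\<^sup>2 \<le> 3 a / 2 + \<Sum>\<^sub>i (s (X\<^sub>i) - E s)\<close>. The differences of all moments of two
  two-point laws are controlled by the first three, and these by Hellinger divergence, so
  \<open>\<bar>s' t\<bar> \<le> C h exp (L \<bar>t\<bar>)\<close> uniformly over the model. Integrating \<open>s'\<close> against the centred
  empirical distribution function therefore bounds the sum by \<open>sqrt n h W\<close>, where \<open>W\<close> has
  bounded second moment and does not depend on \<open>f\<close>; no chaining is needed, and \<open>n h\<^sup>2\<close> has
  bounded expectation.

  Lower bound. The means \<open>0\<close> and \<open>1 / sqrt n\<close> cannot be told apart, although the two normal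
  densities are at Hellinger divergence of order \<open>1 / sqrt n\<close>.
\<close>

section \<open>Moments of two-point laws\<close>

text \<open>The obstacle is that the parametrisation degenerates where the two means merge: weights
  and means are no longer identified, the Fisher information is singular, and distances between
  parameters are not comparable with Hellinger divergence. Moments of the mixing law stay
  comparable. Three of them suffice because the difference of two two-point laws is a signed measure
  of mass zero on at most four points. Inverting a Vandermonde system would show this, but with
  constants that explode as the points merge; linear recurrences give constants depending on
  \<open>b\<close> alone.

  Up to constants, \<open>W\<^sup>2\<close> is \<open>level_energy\<close> divided by
  \<open>n\<close>, a weighted L2 norm of the centred empirical distribution function, dual to the
  functions whose derivative is at most \<open>exp (L * \<bar>t\<bar>)\<close>. It controls the
  whole model on each sample, so a density chosen from the data may be inserted before taking
  expectations.

  The factor \<open>exp (3 * a)\<close> comes from nesting: the fit over the larger model maximises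
  over both, and its penalty is \<open>3 * a / n\<close>.\<close>

definition two_point :: "real \<Rightarrow> real \<Rightarrow> real \<Rightarrow> (real \<Rightarrow> real) \<Rightarrow> real" where
  "two_point w x y g = w * g x + (1 - w) * g y"

definition moment_gap :: "real \<Rightarrow> real \<Rightarrow> real \<Rightarrow> real \<Rightarrow> real \<Rightarrow> real \<Rightarrow> nat \<Rightarrow> real" where
  "moment_gap w x y v z u k =
     two_point w x y (\<lambda>s. s ^ k) - two_point v z u (\<lambda>s. s ^ k)"

text \<open>
  With \<open>q s = (s - x) * (s - y)\<close>, the numbers \<open>E k\<close> are the integrals of \<open>s ^ k * q s\<close> against
  the second two-point law; against the first one these integrals vanish. Hence \<open>E 0\<close> and \<open>E 1\<close>
  only involve the first three moment gaps, and both \<open>E\<close> and the moment gaps solve linear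
  recurrences of order two.
\<close>

lemma moment_gap_bound:
  fixes b w x y v z u :: real
  assumes b: "0 \<le> b" and x: "\<bar>x\<bar> \<le> b" and y: "\<bar>y\<bar> \<le> b" and z: "\<bar>z\<bar> \<le> b" and u: "\<bar>u\<bar> \<le> b"
  defines "D \<equiv> moment_gap w x y v z u"
  shows "\<bar>D k\<bar> \<le> (\<bar>D 1\<bar> + \<bar>D 2\<bar> + \<bar>D 3\<bar>) * (4 * (1 + b)) ^ k"
proof -
  \<comment> \<open>The induction for \<open>D\<close> closes if
    \<open>2 * b * K + b\<^sup>2 + (1 + b)\<^sup>2 \<le> K\<^sup>2\<close>, the last summand on the
    left being the forcing term \<open>E\<close>; the induction for \<open>E\<close> asks for
    less.\<close>
  define K where "K = 4 * (1 + b)"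
  define \<Delta> where "\<Delta> = \<bar>D 1\<bar> + \<bar>D 2\<bar> + \<bar>D 3\<bar>"
  define E where "E k = v * (z ^ k * ((z - x) * (z - y))) + (1 - v) * (u ^ k * ((u - x) * (u - y)))"
    for k :: nat
  have K1: "1 \<le> K" and \<Delta>0: "0 \<le> \<Delta>" using b by (auto simp: K_def \<Delta>_def)
  have D_rec: "D (k + 2) = (x + y) * D (k + 1) - x * y * D k - E k" for k
    unfolding D_def moment_gap_def two_point_def E_def
    by (simp add: algebra_simps power2_eq_square)
  \<comment> \<open>Homogeneous, with characteristic roots \<open>z\<close> and \<open>u\<close>;
    the recurrence for \<open>D\<close> has roots \<open>x\<close> and \<open>y\<close> and forcing
    term \<open>E\<close>. All four roots have modulus at most \<open>b\<close>, so
    \<open>lin2\<close> serves both.\<close>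
  have E_rec: "E (k + 2) = (z + u) * E (k + 1) - z * u * E k" for k
    unfolding E_def by (simp add: algebra_simps power2_eq_square)
  have D0: "D 0 = 0" unfolding D_def moment_gap_def two_point_def by simp
  have lin2: "\<bar>(p + q) * s - p * q * t\<bar> \<le> 2 * b * S + b\<^sup>2 * T"
    if "\<bar>p\<bar> \<le> b" "\<bar>q\<bar> \<le> b" "\<bar>s\<bar> \<le> S" "\<bar>t\<bar> \<le> T" for p q s t S T
  proof -
    have "\<bar>(p + q) * s\<bar> \<le> (2 * b) * S"
      unfolding abs_mult using that b by (intro mult_mono) auto
    moreover have "\<bar>p * q * t\<bar> \<le> b * b * T"
      unfolding abs_mult using that b by (intro mult_mono) auto
    ultimately show ?thesis by (simp add: power2_eq_square)
  qed
  have E_bound: "\<bar>E k\<bar> \<le> (1 + b)\<^sup>2 * \<Delta> * K ^ k" for k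
  proof (induction k rule: induct_nat_012)
    case 0
    have "E 0 = (x + y) * D 1 - x * y * D 0 - D 2"
      using D_rec[of 0] by (simp add: numeral_2_eq_2)
    also have "\<bar>\<dots>\<bar> \<le> \<bar>(x + y) * D 1 - x * y * D 0\<bar> + \<bar>D 2\<bar>" by linarith
    also have "\<dots> \<le> (2 * b * \<bar>D 1\<bar> + b\<^sup>2 * \<bar>D 0\<bar>) + \<bar>D 2\<bar>"
      using lin2[OF x y order_refl order_refl] by simp
    also have "\<dots> \<le> 2 * b * \<Delta> + b\<^sup>2 * \<Delta> + 1 * \<Delta>"
      using b D0 by (intro add_mono mult_left_mono) (auto simp: \<Delta>_def)
    finally show ?case by (simp add: power2_eq_square algebra_simps)
  next
    case 1
    have "E 1 = (x + y) * D 2 - x * y * D 1 - D 3"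
      using D_rec[of 1] by (simp add: numeral_2_eq_2 numeral_3_eq_3)
    also have "\<bar>\<dots>\<bar> \<le> \<bar>(x + y) * D 2 - x * y * D 1\<bar> + \<bar>D 3\<bar>" by linarith
    also have "\<dots> \<le> (2 * b * \<bar>D 2\<bar> + b\<^sup>2 * \<bar>D 1\<bar>) + \<bar>D 3\<bar>"
      using lin2[OF x y order_refl order_refl] by simp
    also have "\<dots> \<le> 2 * b * \<Delta> + b\<^sup>2 * \<Delta> + 1 * \<Delta>"
      using b by (intro add_mono mult_left_mono) (auto simp: \<Delta>_def)
    also have "\<dots> = (1 + b)\<^sup>2 * \<Delta> * 1" by (simp add: power2_eq_square algebra_simps)
    also have "\<dots> \<le> (1 + b)\<^sup>2 * \<Delta> * K" using K1 \<Delta>0 by (intro mult_left_mono) auto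
    finally show ?case by simp
  next
    case (ge2 k)
    let ?c = "(1 + b)\<^sup>2 * \<Delta>"
    have "\<bar>E (k + 2)\<bar> \<le> 2 * b * (?c * K ^ (k + 1)) + b\<^sup>2 * (?c * K ^ k)"
      unfolding E_rec using ge2 by (intro lin2 z u) simp_all
    also have "\<dots> = ?c * K ^ k * (2 * b * K + b\<^sup>2)" by (simp add: algebra_simps)
    also have "\<dots> \<le> ?c * K ^ k * K\<^sup>2"
      using b \<Delta>0 K1 by (intro mult_left_mono) (auto simp: K_def power2_eq_square algebra_simps)
    finally show ?case by (simp add: power2_eq_square algebra_simps)
  qed
  have "\<bar>D k\<bar> \<le> \<Delta> * K ^ k"
  proof (induction k rule: induct_nat_012)
    case 0
    then show ?case using \<Delta>0 D0 by simp
  next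
    case 1
    have "\<bar>D 1\<bar> \<le> \<Delta> * 1" by (simp add: \<Delta>_def)
    also have "\<dots> \<le> \<Delta> * K" using K1 \<Delta>0 by (intro mult_left_mono) auto
    finally show ?case by simp
  next
    case (ge2 k)
    have "\<bar>D (k + 2)\<bar> \<le> \<bar>(x + y) * D (k + 1) - x * y * D k\<bar> + \<bar>E k\<bar>"
      unfolding D_rec by linarith
    also have "\<dots> \<le> (2 * b * (\<Delta> * K ^ (k + 1)) + b\<^sup>2 * (\<Delta> * K ^ k)) + (1 + b)\<^sup>2 * \<Delta> * K ^ k"
      using ge2 by (intro add_mono lin2 x y E_bound) simp_all
    also have "\<dots> = \<Delta> * K ^ k * (2 * b * K + b\<^sup>2 + (1 + b)\<^sup>2)" by (simp add: algebra_simps)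
    also have "\<dots> \<le> \<Delta> * K ^ k * K\<^sup>2"
      using b \<Delta>0 K1 by (intro mult_left_mono) (auto simp: K_def power2_eq_square algebra_simps)
    finally show ?case by (simp add: power2_eq_square algebra_simps)
  qed
  then show ?thesis by (simp add: K_def \<Delta>_def)
qed

text \<open>Integration against a two-point law is a finite sum and commutes with convergent series.
  This carries bounds on moment gaps over to functions given by power series.\<close>

lemma two_point_diff_series:
  fixes e :: "nat \<Rightarrow> real \<Rightarrow> real"
  assumes g: "\<And>s. (\<lambda>i. e i s) sums g s"
    and e: "\<And>i. \<bar>two_point w x y (e i) - two_point v z u (e i)\<bar> \<le> \<beta> i"
    and \<beta>: "\<beta> sums S"
  shows "\<bar>two_point w x y g - two_point v z u g\<bar> \<le> S"
proof -
  have s: "(\<lambda>i. two_point w x y (e i) - two_point v z u (e i)) sums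
      (two_point w x y g - two_point v z u g)"
    unfolding two_point_def by (intro sums_diff sums_add sums_mult g)
  have "norm (\<Sum>i. two_point w x y (e i) - two_point v z u (e i)) \<le> suminf \<beta>"
    using \<beta> e by (intro norm_suminf_le) (auto simp: sums_iff)
  then show ?thesis using s \<beta> by (simp add: sums_iff)
qed

text \<open>The function \<open>exp (t * s - s\<^sup>2 / 2)\<close> of \<open>s\<close> is the
  density of N(s,1) relative to N(0,1) at \<open>t\<close>. Its two exponential factors are expanded
  one after the other, each moment gap being replaced by its geometric bound; absolute values turn
  \<open>- s\<^sup>2 / 2\<close> into \<open>K\<^sup>2 / 2\<close>. Later \<open>k = 0\<close> gives
  the ratio and \<open>k = 1\<close> its derivative in \<open>t\<close>.\<close>

lemma two_point_exp_diff_bound: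
  fixes b w x y v z u t :: real and k :: nat
  assumes b: "0 \<le> b" and x: "\<bar>x\<bar> \<le> b" and y: "\<bar>y\<bar> \<le> b" and z: "\<bar>z\<bar> \<le> b" and u: "\<bar>u\<bar> \<le> b"
  defines "D \<equiv> moment_gap w x y v z u" and "K \<equiv> 4 * (1 + b)"
  shows "\<bar>two_point w x y (\<lambda>s. s ^ k * exp (t * s - s\<^sup>2 / 2)) -
          two_point v z u (\<lambda>s. s ^ k * exp (t * s - s\<^sup>2 / 2))\<bar>
    \<le> (\<bar>D 1\<bar> + \<bar>D 2\<bar> + \<bar>D 3\<bar>) * K ^ k * exp (K * \<bar>t\<bar> + K\<^sup>2 / 2)"
proof -
  define \<Delta> where "\<Delta> = \<bar>D 1\<bar> + \<bar>D 2\<bar> + \<bar>D 3\<bar>"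
  let ?T = "\<lambda>g. two_point w x y g - two_point v z u g"
  have exp_sums: "(\<lambda>i. r ^ i / fact i) sums exp r" for r :: real
    using exp_converges[of r] by (simp add: field_simps)
  have *: "\<bar>?T (\<lambda>s. s ^ j * exp (t * s))\<bar> \<le> \<Delta> * K ^ j * exp (K * \<bar>t\<bar>)" for j
  proof (rule two_point_diff_series)
    show "(\<lambda>i. s ^ j * ((t * s) ^ i / fact i)) sums (s ^ j * exp (t * s))" for s
      by (intro sums_mult exp_sums)
    show "(\<lambda>i. \<Delta> * K ^ j * ((K * \<bar>t\<bar>) ^ i / fact i)) sums (\<Delta> * K ^ j * exp (K * \<bar>t\<bar>))"
      by (intro sums_mult exp_sums)
    fix i
    have "?T (\<lambda>s. s ^ j * ((t * s) ^ i / fact i)) = t ^ i / fact i * D (j + i)"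
      unfolding D_def moment_gap_def two_point_def
      by (simp add: power_add power_mult_distrib algebra_simps add_divide_distrib diff_divide_distrib)
    also have "\<bar>\<dots>\<bar> \<le> \<bar>t\<bar> ^ i / fact i * (\<Delta> * K ^ (j + i))"
      unfolding abs_mult D_def \<Delta>_def K_def
      by (intro mult_mono moment_gap_bound b x y z u) (simp_all add: power_abs)
    finally show "\<bar>?T (\<lambda>s. s ^ j * ((t * s) ^ i / fact i))\<bar> \<le> \<Delta> * K ^ j * ((K * \<bar>t\<bar>) ^ i / fact i)"
      by (simp add: power_add power_mult_distrib algebra_simps)
  qed
  have "\<bar>?T (\<lambda>s. s ^ k * exp (t * s - s\<^sup>2 / 2))\<bar> \<le> \<Delta> * K ^ k * exp (K * \<bar>t\<bar>) * exp (K\<^sup>2 / 2)"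
  proof (rule two_point_diff_series)
    show "(\<lambda>i. s ^ k * exp (t * s) * ((- s\<^sup>2 / 2) ^ i / fact i)) sums (s ^ k * exp (t * s - s\<^sup>2 / 2))"
      for s
    proof -
      have "(\<lambda>i. s ^ k * exp (t * s) * ((- s\<^sup>2 / 2) ^ i / fact i)) sums
          (s ^ k * exp (t * s) * exp (- s\<^sup>2 / 2))"
        by (intro sums_mult exp_sums)
      also have "s ^ k * exp (t * s) * exp (- s\<^sup>2 / 2) = s ^ k * exp (t * s - s\<^sup>2 / 2)"
        by (simp add: mult_exp_exp mult.assoc)
      finally show ?thesis .
    qed
    show "(\<lambda>i. \<Delta> * K ^ k * exp (K * \<bar>t\<bar>) * ((K\<^sup>2 / 2) ^ i / fact i)) sums
        (\<Delta> * K ^ k * exp (K * \<bar>t\<bar>) * exp (K\<^sup>2 / 2))"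
      by (intro sums_mult exp_sums)
    fix i
    have "?T (\<lambda>s. s ^ k * exp (t * s) * ((- s\<^sup>2 / 2) ^ i / fact i)) =
        (- 1 / 2) ^ i / fact i * ?T (\<lambda>s. s ^ (k + 2 * i) * exp (t * s))"
    proof -
      have "(- s\<^sup>2 / 2) ^ i = (- 1 / 2) ^ i * s ^ (2 * i)" for s :: real
        by (simp add: power_mult power_mult_distrib[symmetric])
      then show ?thesis unfolding two_point_def
        by (simp add: power_add algebra_simps add_divide_distrib diff_divide_distrib)
    qed
    also have "\<bar>\<dots>\<bar> \<le> (1 / 2) ^ i / fact i * (\<Delta> * K ^ (k + 2 * i) * exp (K * \<bar>t\<bar>))"
      unfolding abs_mult by (intro mult_mono *) (simp_all add: power_abs)
    also have "\<dots> = \<Delta> * K ^ k * exp (K * \<bar>t\<bar>) * ((K\<^sup>2 / 2) ^ i / fact i)"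
      by (simp add: power_add power_divide power_mult_distrib power2_eq_square mult_2)
    finally show "\<bar>?T (\<lambda>s. s ^ k * exp (t * s) * ((- s\<^sup>2 / 2) ^ i / fact i))\<bar>
        \<le> \<Delta> * K ^ k * exp (K * \<bar>t\<bar>) * ((K\<^sup>2 / 2) ^ i / fact i)" .
  qed
  then show ?thesis by (simp add: \<Delta>_def exp_add mult.assoc)
qed

section \<open>Likelihood ratios of normal mixtures\<close>

lemma two_point_le: "0 \<le> w \<Longrightarrow> w \<le> 1 \<Longrightarrow> g x \<le> c \<Longrightarrow> g y \<le> c \<Longrightarrow> two_point w x y g \<le> c"
  for c :: real
  unfolding two_point_def using convex_bound_le[of "g x" c "g y" w "1 - w"] by simp

lemma two_point_ge: "0 \<le> w \<Longrightarrow> w \<le> 1 \<Longrightarrow> c \<le> g x \<Longrightarrow> c \<le> g y \<Longrightarrow> c \<le> two_point w x y g"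
  for c :: real
  using two_point_le[of w "\<lambda>s. - g s" x "- c" y] by (simp add: two_point_def)

lemma two_point_abs_le:
  "0 \<le> w \<Longrightarrow> w \<le> 1 \<Longrightarrow> \<bar>g x\<bar> \<le> c \<Longrightarrow> \<bar>g y\<bar> \<le> c \<Longrightarrow> \<bar>two_point w x y g\<bar> \<le> c"
  for c :: real
  using two_point_le[of w g x c y] two_point_ge[of w "- c" g x y] by (simp add: abs_le_iff)

abbreviation normal_mixture :: "real \<Rightarrow> real \<Rightarrow> real \<Rightarrow> real \<Rightarrow> real" where
  "normal_mixture w x y t \<equiv> two_point w x y (\<lambda>s. normal_density s 1 t)"

text \<open>A common superset of \<open>model1\<close> and \<open>model2\<close>, so that a fitted
  density and the true one are compared without distinguishing the models they come from.\<close>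

definition normal_mixtures :: "real \<Rightarrow> (real \<Rightarrow> real) set" where
  "normal_mixtures b = {normal_mixture w x y | w x y. 0 \<le> w \<and> w \<le> 1 \<and> \<bar>x\<bar> \<le> b \<and> \<bar>y\<bar> \<le> b}"

lemma normal_density_tilt: "normal_density s 1 t = std_normal_density t * exp (t * s - s\<^sup>2 / 2)"
  by (simp add: normal_density_def mult_exp_exp power2_eq_square field_simps)

lemma normal_mixture_tilt:
  "normal_mixture w x y t = std_normal_density t * two_point w x y (\<lambda>s. exp (t * s - s\<^sup>2 / 2))"
  unfolding two_point_def normal_density_tilt[of x] normal_density_tilt[of y] by (simp add: algebra_simps)

lemma exp_tilt_bounds:
  fixes s b t :: real
  assumes "\<bar>s\<bar> \<le> b"
  shows "exp (t * s - s\<^sup>2 / 2) \<le> exp (b * \<bar>t\<bar>)"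
    and "exp (- b * \<bar>t\<bar> - b\<^sup>2 / 2) \<le> exp (t * s - s\<^sup>2 / 2)"
    and "\<bar>s * exp (t * s - s\<^sup>2 / 2)\<bar> \<le> b * exp (b * \<bar>t\<bar>)"
proof -
  have ts: "\<bar>t * s\<bar> \<le> b * \<bar>t\<bar>"
    using mult_right_mono[OF assms, of "\<bar>t\<bar>"] by (simp add: abs_mult mult.commute)
  have ss: "s\<^sup>2 \<le> b\<^sup>2" using assms abs_le_square_iff[of s b] by simp
  show *: "exp (t * s - s\<^sup>2 / 2) \<le> exp (b * \<bar>t\<bar>)"
    using ts zero_le_power2[of s] by (subst exp_le_cancel_iff) linarith
  show "exp (- b * \<bar>t\<bar> - b\<^sup>2 / 2) \<le> exp (t * s - s\<^sup>2 / 2)"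
    using ts ss by (subst exp_le_cancel_iff) simp
  show "\<bar>s * exp (t * s - s\<^sup>2 / 2)\<bar> \<le> b * exp (b * \<bar>t\<bar>)"
    unfolding abs_mult using assms * by (intro mult_mono) auto
qed

text \<open>The standard normal factor cancels and leaves \<open>sqrt (R / Q)\<close>. The numerator
  of its derivative is \<open>(R' - Q') * Q - (R - Q) * Q'\<close>, so each term carries a moment
  gap. The denominator is twice \<open>Q * sqrt (R * Q)\<close>, which is at least
  \<open>m * m\<close>. In the rate \<open>K + 3 * b\<close>, \<open>K\<close> comes from the
  differences, one \<open>b\<close> from \<open>Q\<close> and \<open>Q'\<close>, and
  \<open>2 * b\<close> from \<open>1 / (m * m)\<close>.\<close>

lemma sqrt_mixture_ratio_deriv:
  fixes b w x y v z u :: real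
  assumes b: "0 \<le> b" and x: "\<bar>x\<bar> \<le> b" and y: "\<bar>y\<bar> \<le> b" and z: "\<bar>z\<bar> \<le> b" and u: "\<bar>u\<bar> \<le> b"
    and w: "0 \<le> w" "w \<le> 1" and v: "0 \<le> v" "v \<le> 1"
  defines "D \<equiv> moment_gap w x y v z u" and "K \<equiv> 4 * (1 + b)"
  shows "\<exists>s'. (\<forall>t. ((\<lambda>t. sqrt (normal_mixture w x y t / normal_mixture v z u t))
        has_real_derivative s' t) (at t)) \<and> continuous_on UNIV s' \<and>
     (\<forall>t. \<bar>s' t\<bar> \<le> (\<bar>D 1\<bar> + \<bar>D 2\<bar> + \<bar>D 3\<bar>) * (K * (1 + b) * exp (K\<^sup>2 / 2 + b\<^sup>2)) *
        exp ((K + 3 * b) * \<bar>t\<bar>))"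
proof -
  define \<Delta> where "\<Delta> = \<bar>D 1\<bar> + \<bar>D 2\<bar> + \<bar>D 3\<bar>"
  define R where "R t = two_point w x y (\<lambda>s. exp (t * s - s\<^sup>2 / 2))" for t
  define R' where "R' t = two_point w x y (\<lambda>s. s * exp (t * s - s\<^sup>2 / 2))" for t
  define Q where "Q t = two_point v z u (\<lambda>s. exp (t * s - s\<^sup>2 / 2))" for t
  define Q' where "Q' t = two_point v z u (\<lambda>s. s * exp (t * s - s\<^sup>2 / 2))" for t
  define m where "m t = exp (- b * \<bar>t\<bar> - b\<^sup>2 / 2)" for t
  define E where "E t = exp (K * \<bar>t\<bar> + K\<^sup>2 / 2)" for t
  define s' where "s' t = (R' t * Q t - R t * Q' t) / (Q t * Q t) * (inverse (sqrt (R t / Q t)) / 2)" for t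
  have K1: "1 \<le> K" and \<Delta>0: "0 \<le> \<Delta>" and m0: "0 < m t" and E0: "0 < E t" for t
    using b by (auto simp: K_def \<Delta>_def m_def E_def)
  have Rm: "m t \<le> R t" and Qm: "m t \<le> Q t" for t
    unfolding R_def Q_def m_def by (intro two_point_ge exp_tilt_bounds x y z u w v)+
  have pos: "0 < R t" "0 < Q t" for t
    using Rm[of t] Qm[of t] m0[of t] by linarith+
  have Qb: "Q t \<le> exp (b * \<bar>t\<bar>)" and Q'b: "\<bar>Q' t\<bar> \<le> b * exp (b * \<bar>t\<bar>)" for t
    unfolding Q_def Q'_def by (intro two_point_le two_point_abs_le exp_tilt_bounds z u v)+
  have "\<bar>R t - Q t\<bar> \<le> \<Delta> * 1 * E t" for t
    using two_point_exp_diff_bound[OF b x y z u, of w 0 t v]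
    by (simp add: R_def Q_def \<Delta>_def D_def K_def E_def)
  also have "\<Delta> * 1 * E t \<le> \<Delta> * K * E t" for t
    using K1 \<Delta>0 E0[of t] by (intro mult_right_mono mult_left_mono) auto
  finally have dR: "\<bar>R t - Q t\<bar> \<le> \<Delta> * K * E t" for t .
  have dR': "\<bar>R' t - Q' t\<bar> \<le> \<Delta> * K * E t" for t
    using two_point_exp_diff_bound[OF b x y z u, of w 1 t v]
    by (simp add: R'_def Q'_def \<Delta>_def D_def K_def E_def)
  have R_deriv: "(R has_real_derivative R' t) (at t)" for t
    unfolding R_def R'_def two_point_def
    by (auto intro!: derivative_eq_intros simp: algebra_simps)
  have Q_deriv: "(Q has_real_derivative Q' t) (at t)" for t
    unfolding Q_def Q'_def two_point_def
    by (auto intro!: derivative_eq_intros simp: algebra_simps)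
  have eq: "(\<lambda>t. sqrt (normal_mixture w x y t / normal_mixture v z u t)) = (\<lambda>t. sqrt (R t / Q t))"
    unfolding normal_mixture_tilt R_def Q_def
    using normal_density_pos[of 1 0] by (auto simp: less_imp_neq[symmetric])
  have "((\<lambda>t. sqrt (R t / Q t)) has_real_derivative s' t) (at t)" for t
  proof -
    have "((\<lambda>t. R t / Q t) has_real_derivative (R' t * Q t - R t * Q' t) / (Q t * Q t)) (at t)"
      using pos[of t] by (intro DERIV_divide R_deriv Q_deriv) auto
    from DERIV_chain2[OF DERIV_real_sqrt this] pos[of t]
    show ?thesis by (simp add: s'_def mult.commute)
  qed
  moreover have "continuous_on UNIV s'"
  proof -
    have "continuous_on UNIV R" "continuous_on UNIV Q" "continuous_on UNIV R'" "continuous_on UNIV Q'"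
      unfolding R_def Q_def R'_def Q'_def two_point_def by (intro continuous_intros)+
    then show ?thesis unfolding s'_def
      using pos by (intro continuous_intros) (auto simp: less_imp_neq[symmetric])
  qed
  moreover have "\<bar>s' t\<bar> \<le> \<Delta> * (K * (1 + b) * exp (K\<^sup>2 / 2 + b\<^sup>2)) * exp ((K + 3 * b) * \<bar>t\<bar>)" for t
  proof -
    have "R' t * Q t - R t * Q' t = (R' t - Q' t) * Q t - (R t - Q t) * Q' t"
      by (simp add: algebra_simps)
    also have "\<bar>\<dots>\<bar> \<le> \<bar>R' t - Q' t\<bar> * \<bar>Q t\<bar> + \<bar>R t - Q t\<bar> * \<bar>Q' t\<bar>"
      unfolding abs_mult[symmetric] by linarith
    also have "\<dots> \<le> \<Delta> * K * E t * exp (b * \<bar>t\<bar>) + \<Delta> * K * E t * (b * exp (b * \<bar>t\<bar>))"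
      using pos(2)[of t] dR[of t] dR'[of t] Qb[of t] Q'b[of t] \<Delta>0 K1 E0[of t]
      by (intro add_mono mult_mono) auto
    also have "\<dots> = \<Delta> * K * (1 + b) * E t * exp (b * \<bar>t\<bar>)" by (simp add: algebra_simps)
    finally have num: "\<bar>R' t * Q t - R t * Q' t\<bar> \<le> \<Delta> * K * (1 + b) * E t * exp (b * \<bar>t\<bar>)" .
    have sqrt_eq: "Q t * Q t * sqrt (R t / Q t) = Q t * sqrt (R t * Q t)"
    proof -
      have "Q t = sqrt (Q t) * sqrt (Q t)" using pos[of t] by simp
      then show ?thesis using pos[of t] by (simp add: real_sqrt_divide real_sqrt_mult field_simps)
    qed
    have "m t * sqrt (m t * m t) \<le> Q t * sqrt (R t * Q t)"
      using Rm[of t] Qm[of t] m0[of t] by (intro mult_mono real_sqrt_le_mono) auto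
    then have den: "m t * m t \<le> Q t * Q t * sqrt (R t / Q t)"
      unfolding sqrt_eq using m0[of t] by simp
    have half_le: "r / 2 \<le> r" if "0 \<le> r" for r :: real using that by simp
    have mm: "m t * m t = exp (- (2 * b * \<bar>t\<bar> + b\<^sup>2))"
      by (simp add: m_def mult_exp_exp)
    have "\<bar>s' t\<bar> = \<bar>R' t * Q t - R t * Q' t\<bar> / (Q t * Q t * sqrt (R t / Q t)) / 2"
      unfolding s'_def using pos[of t] by (simp add: abs_mult field_simps)
    also have "\<dots> \<le> \<bar>R' t * Q t - R t * Q' t\<bar> / (Q t * Q t * sqrt (R t / Q t))"
      by (rule half_le) (use pos[of t] in simp)
    also have "\<dots> \<le> (\<Delta> * K * (1 + b) * E t * exp (b * \<bar>t\<bar>)) / (m t * m t)"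
      using num den m0[of t] by (intro frac_le) auto
    also have "\<dots> = \<Delta> * (K * (1 + b)) * (E t * exp (b * \<bar>t\<bar>) * exp (2 * b * \<bar>t\<bar> + b\<^sup>2))"
      unfolding mm exp_minus by (simp only: divide_inverse inverse_inverse_eq mult.assoc)
    also have "E t * exp (b * \<bar>t\<bar>) * exp (2 * b * \<bar>t\<bar> + b\<^sup>2) =
        exp (K\<^sup>2 / 2 + b\<^sup>2) * exp ((K + 3 * b) * \<bar>t\<bar>)"
      by (simp add: E_def mult_exp_exp algebra_simps)
    finally show ?thesis by (simp add: mult.assoc)
  qed
  ultimately show ?thesis unfolding eq \<Delta>_def[symmetric] by blast
qed

section \<open>Hellinger divergence\<close>

lemma prob_density_integrable:
  assumes "prob_density f"
  shows "integrable lborel f" and "(\<integral>t. f t \<partial>lborel) = 1"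
proof -
  have "has_bochner_integral lborel f 1"
    using assms by (intro has_bochner_integral_nn_integral) (auto simp: prob_density_def)
  then show "integrable lborel f" "(\<integral>t. f t \<partial>lborel) = 1"
    by (auto simp: has_bochner_integral_iff)
qed

lemma sqrt_diff_square_le:
  fixes r s :: real
  assumes "0 \<le> r" "0 \<le> s"
  shows "(sqrt r - sqrt s)\<^sup>2 \<le> r + s"
  using assms by (simp add: power2_diff)

lemma hellinger_integrable:
  assumes f: "prob_density f" and g: "prob_density g"
  shows "integrable lborel (\<lambda>t. (sqrt (f t) - sqrt (g t))\<^sup>2)"
proof (rule Bochner_Integration.integrable_bound)
  show "integrable lborel (\<lambda>t. f t + g t)"
    using prob_density_integrable[OF f] prob_density_integrable[OF g] by auto
  have [measurable]: "f \<in> borel_measurable borel" "g \<in> borel_measurable borel"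
    using f g by (auto simp: prob_density_def)
  show "(\<lambda>t. (sqrt (f t) - sqrt (g t))\<^sup>2) \<in> borel_measurable lborel" by measurable
  show "AE t in lborel. norm ((sqrt (f t) - sqrt (g t))\<^sup>2) \<le> norm (f t + g t)"
    using f g by (auto simp: prob_density_def sqrt_diff_square_le)
qed

lemma hellinger_sq: "(hellinger f g)\<^sup>2 = 1 / 2 * (\<integral>t. (sqrt (f t) - sqrt (g t))\<^sup>2 \<partial>lborel)"
  unfolding hellinger_def by (subst real_sqrt_pow2) auto

lemma hellinger_nonneg: "0 \<le> hellinger f g"
  unfolding hellinger_def by simp

lemma hellinger_sq_nn_integral:
  assumes "prob_density f" "prob_density g"
  shows "(\<integral>\<^sup>+t. ennreal ((sqrt (f t) - sqrt (g t))\<^sup>2) \<partial>lborel) = ennreal (2 * (hellinger f g)\<^sup>2)"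
  using hellinger_integrable[OF assms] by (subst nn_integral_eq_integral) (auto simp: hellinger_sq)

lemma hellinger_affinity:
  assumes f: "prob_density f" and g: "prob_density g"
  shows "has_bochner_integral lborel (\<lambda>t. sqrt (f t) * sqrt (g t)) (1 - (hellinger f g)\<^sup>2)"
proof -
  have eq: "sqrt (f t) * sqrt (g t) = (f t + g t - (sqrt (f t) - sqrt (g t))\<^sup>2) / 2" for t
    using f g by (simp add: prob_density_def power2_diff)
  have "has_bochner_integral lborel (\<lambda>t. (f t + g t - (sqrt (f t) - sqrt (g t))\<^sup>2) / 2)
      ((1 + 1 - (\<integral>t. (sqrt (f t) - sqrt (g t))\<^sup>2 \<partial>lborel)) / 2)"
    using prob_density_integrable[OF f] prob_density_integrable[OF g] hellinger_integrable[OF f g]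
    by (intro has_bochner_integral_divide_zero has_bochner_integral_diff has_bochner_integral_add)
      (auto simp: has_bochner_integral_iff)
  then show ?thesis unfolding eq hellinger_sq by (simp add: diff_divide_distrib)
qed

text \<open>Factor \<open>f - g\<close> as \<open>(sqrt f - sqrt g) * (sqrt f + sqrt g)\<close> and
  apply Cauchy-Schwarz. The first factor contributes \<open>2 * h\<^sup>2\<close>, the second at
  most \<open>2 * B\<close> because
  \<open>(sqrt f + sqrt g)\<^sup>2 \<le> 2 * (f + g)\<close>.\<close>

lemma hellinger_integral_diff:
  assumes f: "prob_density f" and g: "prob_density g"
    and [measurable]: "\<psi> \<in> borel_measurable borel"
    and \<psi>f: "integrable lborel (\<lambda>t. \<psi> t * f t)" and \<psi>g: "integrable lborel (\<lambda>t. \<psi> t * g t)"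
    and B: "(\<integral>\<^sup>+t. ennreal ((\<psi> t)\<^sup>2 * (f t + g t)) \<partial>lborel) \<le> ennreal B" and B0: "0 \<le> B"
  shows "\<bar>(\<integral>t. \<psi> t * f t \<partial>lborel) - (\<integral>t. \<psi> t * g t \<partial>lborel)\<bar> \<le> 2 * sqrt B * hellinger f g"
proof -
  define I where "I = \<bar>(\<integral>t. \<psi> t * f t \<partial>lborel) - (\<integral>t. \<psi> t * g t \<partial>lborel)\<bar>"
  have fg: "0 \<le> f t" "0 \<le> g t" for t using f g by (auto simp: prob_density_def)
  have [measurable]: "f \<in> borel_measurable borel" "g \<in> borel_measurable borel"
    using f g by (auto simp: prob_density_def)
  let ?a = "\<lambda>t. \<bar>sqrt (f t) - sqrt (g t)\<bar>" and ?c = "\<lambda>t. \<bar>\<psi> t\<bar> * (sqrt (f t) + sqrt (g t))"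
  have "ennreal I = ennreal (norm (\<integral>t. \<psi> t * f t - \<psi> t * g t \<partial>lborel))"
    using \<psi>f \<psi>g by (simp add: I_def)
  also have "\<dots> \<le> (\<integral>\<^sup>+t. norm (\<psi> t * f t - \<psi> t * g t) \<partial>lborel)"
    using \<psi>f \<psi>g by (intro integral_norm_bound_ennreal) auto
  also have "\<dots> = (\<integral>\<^sup>+t. ennreal (?a t) * ennreal (?c t) \<partial>lborel)"
  proof (intro nn_integral_cong)
    fix t
    have "f t - g t = (sqrt (f t) - sqrt (g t)) * (sqrt (f t) + sqrt (g t))"
      using fg[of t] by (simp add: algebra_simps)
    then have "\<psi> t * f t - \<psi> t * g t = (sqrt (f t) - sqrt (g t)) * (\<psi> t * (sqrt (f t) + sqrt (g t)))"
      by (simp add: right_diff_distrib[symmetric])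
    then have "norm (\<psi> t * f t - \<psi> t * g t) = ?a t * ?c t"
      using fg[of t] by (simp add: abs_mult)
    then show "ennreal (norm (\<psi> t * f t - \<psi> t * g t)) = ennreal (?a t) * ennreal (?c t)"
      using fg[of t] by (simp add: ennreal_mult)
  qed
  finally have "(ennreal I)\<^sup>2 \<le> (\<integral>\<^sup>+t. ennreal (?a t) * ennreal (?c t) \<partial>lborel)\<^sup>2"
    by (intro power_mono) auto
  also have "\<dots> \<le> (\<integral>\<^sup>+t. ennreal (?a t)^2 \<partial>lborel) * (\<integral>\<^sup>+t. ennreal (?c t)^2 \<partial>lborel)"
    by (intro Cauchy_Schwarz_nn_integral) measurable
  also have "(\<integral>\<^sup>+t. ennreal (?a t)^2 \<partial>lborel) = ennreal (2 * (hellinger f g)\<^sup>2)"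
    using hellinger_sq_nn_integral[OF f g] by (simp add: ennreal_power)
  also have "(\<integral>\<^sup>+t. ennreal (?c t)^2 \<partial>lborel)
      \<le> (\<integral>\<^sup>+t. ennreal 2 * ennreal ((\<psi> t)\<^sup>2 * (f t + g t)) \<partial>lborel)"
  proof (intro nn_integral_mono)
    fix t
    have "(sqrt (f t) + sqrt (g t))\<^sup>2 \<le> 2 * (f t + g t)"
      using fg[of t] sum_squares_bound[of "sqrt (f t)" "sqrt (g t)"] by (simp add: power2_sum)
    then have "(\<psi> t)\<^sup>2 * (sqrt (f t) + sqrt (g t))\<^sup>2 \<le> (\<psi> t)\<^sup>2 * (2 * (f t + g t))"
      by (intro mult_left_mono) auto
    also have "\<dots> = 2 * ((\<psi> t)\<^sup>2 * (f t + g t))" by simp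
    finally have "(?c t)\<^sup>2 \<le> 2 * ((\<psi> t)\<^sup>2 * (f t + g t))"
      unfolding power_mult_distrib power2_abs .
    then show "ennreal (?c t)^2 \<le> ennreal 2 * ennreal ((\<psi> t)\<^sup>2 * (f t + g t))"
      using fg[of t] by (simp add: ennreal_power ennreal_mult[symmetric] ennreal_leI del: ennreal_numeral)
  qed
  also have "\<dots> \<le> ennreal (2 * B)"
    using B B0 by (subst nn_integral_cmult) (auto simp: ennreal_mult intro!: mult_left_mono)
  also have "ennreal (2 * (hellinger f g)\<^sup>2) * ennreal (2 * B) = ennreal (4 * B * (hellinger f g)\<^sup>2)"
    using B0 by (simp add: ennreal_mult[symmetric] algebra_simps)
  finally have "ennreal (I\<^sup>2) \<le> ennreal (4 * B * (hellinger f g)\<^sup>2)"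
    by (simp add: ennreal_power I_def mult_left_mono)
  then have "I\<^sup>2 \<le> (2 * sqrt B * hellinger f g)\<^sup>2"
    using B0 by (subst (asm) ennreal_le_iff) (auto simp: power_mult_distrib)
  then show ?thesis unfolding I_def[symmetric]
    using B0 hellinger_nonneg[of f g] by (intro power2_le_imp_le[of I]) auto
qed

section \<open>Exponential moments and positivity of normal mixtures\<close>

lemma normal_density_exp_shift:
  "exp (c * t) * normal_density s 1 t = exp (c * s + c\<^sup>2 / 2) * normal_density (s + c) 1 t"
  by (simp add: normal_density_def mult_exp_exp power2_eq_square field_simps)

lemma nn_integral_normal_density: "0 < \<sigma> \<Longrightarrow> (\<integral>\<^sup>+t. ennreal (normal_density \<mu> \<sigma> t) \<partial>lborel) = 1"
  using nn_integral_eq_integral[OF integrable_normal_density, of \<sigma> \<mu>] by simp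

lemma nn_integral_two_point:
  assumes "0 \<le> w" "w \<le> 1" and [measurable]: "\<And>s. g s \<in> borel_measurable M"
    and "\<And>s t. 0 \<le> g s t"
  shows "(\<integral>\<^sup>+t. ennreal (two_point w x y (\<lambda>s. g s t)) \<partial>M) =
    ennreal w * (\<integral>\<^sup>+t. ennreal (g x t) \<partial>M) + ennreal (1 - w) * (\<integral>\<^sup>+t. ennreal (g y t) \<partial>M)"
  using assms unfolding two_point_def
  by (simp add: ennreal_mult nn_integral_add nn_integral_cmult)

text \<open>Since \<open>exp (c * \<bar>t\<bar>) \<le> exp (c * t) + exp (- c * t)\<close>, two
  exponential tilts suffice, and each tilt of a normal density is a multiple of a shifted
  one.\<close>

lemma nn_integral_exp_normal_density:
  assumes "0 \<le> c" "\<bar>s\<bar> \<le> b"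
  shows "(\<integral>\<^sup>+t. ennreal (exp (c * \<bar>t\<bar>) * normal_density s 1 t) \<partial>lborel)
    \<le> ennreal (2 * exp (c * b + c\<^sup>2 / 2))"
proof -
  let ?E = "exp (c * b + c\<^sup>2 / 2)"
  have "exp (c * \<bar>t\<bar>) * normal_density s 1 t
      \<le> ?E * normal_density (s + c) 1 t + ?E * normal_density (s - c) 1 t" for t
  proof -
    have "exp (c * \<bar>t\<bar>) \<le> exp (c * t) + exp (- c * t)"
      by (cases "0 \<le> t") auto
    then have "exp (c * \<bar>t\<bar>) * normal_density s 1 t
        \<le> exp (c * t) * normal_density s 1 t + exp (- c * t) * normal_density s 1 t"
      unfolding distrib_right[symmetric] by (intro mult_right_mono) auto
    also have "\<dots> = exp (c * s + c\<^sup>2 / 2) * normal_density (s + c) 1 t +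
        exp (- c * s + c\<^sup>2 / 2) * normal_density (s - c) 1 t"
      unfolding normal_density_exp_shift by simp
    also have "\<dots> \<le> ?E * normal_density (s + c) 1 t + ?E * normal_density (s - c) 1 t"
    proof (intro add_mono mult_right_mono)
      have "\<bar>c * s\<bar> \<le> c * b" unfolding abs_mult using assms by (simp add: mult_left_mono)
      then show "exp (c * s + c\<^sup>2 / 2) \<le> ?E" "exp (- c * s + c\<^sup>2 / 2) \<le> ?E" by auto
    qed auto
    finally show ?thesis .
  qed
  then have "(\<integral>\<^sup>+t. ennreal (exp (c * \<bar>t\<bar>) * normal_density s 1 t) \<partial>lborel)
      \<le> (\<integral>\<^sup>+t. ennreal (?E * normal_density (s + c) 1 t + ?E * normal_density (s - c) 1 t) \<partial>lborel)"
    by (intro nn_integral_mono ennreal_leI)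
  also have "\<dots> = ennreal (?E) * 1 + ennreal (?E) * 1"
    by (simp add: ennreal_mult nn_integral_add nn_integral_cmult nn_integral_normal_density)
  also have "\<dots> = ennreal (2 * ?E)" by (simp flip: ennreal_plus)
  finally show ?thesis .
qed

lemma normal_mixture_exp_moment:
  assumes "f \<in> normal_mixtures b" "0 \<le> c"
  shows "(\<integral>\<^sup>+t. ennreal (exp (c * \<bar>t\<bar>) * f t) \<partial>lborel) \<le> ennreal (2 * exp (c * b + c\<^sup>2 / 2))"
proof -
  obtain w x y where f: "f = normal_mixture w x y" and w: "0 \<le> w" "w \<le> 1"
    and xy: "\<bar>x\<bar> \<le> b" "\<bar>y\<bar> \<le> b"
    using assms(1) unfolding normal_mixtures_def by blast
  let ?E = "ennreal (2 * exp (c * b + c\<^sup>2 / 2))"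
  have "(\<integral>\<^sup>+t. ennreal (exp (c * \<bar>t\<bar>) * f t) \<partial>lborel) =
      (\<integral>\<^sup>+t. ennreal (two_point w x y (\<lambda>s. exp (c * \<bar>t\<bar>) * normal_density s 1 t)) \<partial>lborel)"
    by (intro nn_integral_cong) (simp add: f two_point_def algebra_simps)
  also have "\<dots> \<le> ennreal w * ?E + ennreal (1 - w) * ?E"
    using w xy assms(2) nn_integral_exp_normal_density[of c]
    by (subst nn_integral_two_point) (auto intro!: add_mono mult_left_mono)
  also have "\<dots> = ?E"
    using w by (simp flip: distrib_right ennreal_plus)
  finally show ?thesis .
qed

lemma normal_mixture_prob_density: "f \<in> normal_mixtures b \<Longrightarrow> prob_density f"
proof -
  assume "f \<in> normal_mixtures b"
  then obtain w x y where f: "f = normal_mixture w x y" and w: "0 \<le> w" "w \<le> 1"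
    unfolding normal_mixtures_def by blast
  have "(\<integral>\<^sup>+t. ennreal (f t) \<partial>lborel) = 1"
    unfolding f using w
    by (subst nn_integral_two_point) (auto simp: nn_integral_normal_density simp flip: ennreal_plus)
  moreover have "f \<in> borel_measurable borel" unfolding f two_point_def by measurable
  ultimately show ?thesis using w unfolding prob_density_def f by (auto intro!: two_point_ge)
qed

lemma normal_mixture_pos: "f \<in> normal_mixtures b \<Longrightarrow> 0 < f t"
proof -
  assume "f \<in> normal_mixtures b"
  then obtain w x y where f: "f = normal_mixture w x y" and w: "0 \<le> w" "w \<le> 1"
    unfolding normal_mixtures_def by blast
  have "0 < min (normal_density x 1 t) (normal_density y 1 t)"
    by (simp add: normal_density_pos)
  also have "\<dots> \<le> f t" unfolding f using w by (intro two_point_ge) auto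
  finally show ?thesis .
qed

lemma full_model_subset:
  assumes "0 \<le> p" "p \<le> 1"
  shows "full_model b p \<subseteq> normal_mixtures b"
proof
  fix f assume "f \<in> full_model b p"
  then consider \<mu> where "f = normal_density \<mu> 1" "\<mu> \<in> {-b..b}"
    | w \<mu>\<^sub>1 \<mu>\<^sub>2 where "f = (\<lambda>t. w * normal_density \<mu>\<^sub>1 1 t + (1 - w) * normal_density \<mu>\<^sub>2 1 t)"
      "w \<in> {p..1 - p}" "\<mu>\<^sub>1 \<in> {-b..b}" "\<mu>\<^sub>2 \<in> {-b..b}"
    unfolding full_model_def model1_def model2_def by blast
  then show "f \<in> normal_mixtures b"
  proof cases
    case 1
    then have "f = normal_mixture 1 \<mu> \<mu>" "\<bar>\<mu>\<bar> \<le> b"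
      by (auto simp: two_point_def fun_eq_iff)
    then show ?thesis unfolding normal_mixtures_def by force
  next
    case 2
    then have "f = normal_mixture w \<mu>\<^sub>1 \<mu>\<^sub>2" "0 \<le> w" "w \<le> 1" "\<bar>\<mu>\<^sub>1\<bar> \<le> b" "\<bar>\<mu>\<^sub>2\<bar> \<le> b"
      using assms by (auto simp: two_point_def fun_eq_iff)
    then show ?thesis unfolding normal_mixtures_def by blast
  qed
qed

section \<open>Hermite polynomials and the moments of the mixing law\<close>

lemma normal_density_moments:
  "has_bochner_integral lborel (\<lambda>t. t * normal_density s 1 t) s"
  "has_bochner_integral lborel (\<lambda>t. t\<^sup>2 * normal_density s 1 t) (s\<^sup>2 + 1)"
  "has_bochner_integral lborel (\<lambda>t. t ^ 3 * normal_density s 1 t) (s ^ 3 + 3 * s)"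
proof -
  let ?n = "normal_density s 1"
  have m0: "has_bochner_integral lborel ?n 1"
    by (simp add: has_bochner_integral_iff)
  have m1: "has_bochner_integral lborel (\<lambda>t. ?n t * (t - s)) 0"
    using normal_moment_odd[of 1 s 0] by simp
  have m2: "has_bochner_integral lborel (\<lambda>t. ?n t * (t - s)\<^sup>2) 1"
    using normal_moment_even[of 1 s 1] by (simp add: fact_numeral)
  have m3: "has_bochner_integral lborel (\<lambda>t. ?n t * (t - s) ^ 3) 0"
    using normal_moment_odd[of 1 s 1] by (simp add: numeral_3_eq_3)
  have "has_bochner_integral lborel (\<lambda>t. ?n t * (t - s) + s * ?n t) (0 + s * 1)"
    by (intro has_bochner_integral_add has_bochner_integral_mult_right m0 m1)
  then show "has_bochner_integral lborel (\<lambda>t. t * ?n t) s"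
    by (simp add: algebra_simps)
  have "has_bochner_integral lborel (\<lambda>t. ?n t * (t - s)\<^sup>2 + ((2 * s) * (?n t * (t - s)) + s\<^sup>2 * ?n t))
      (1 + ((2 * s) * 0 + s\<^sup>2 * 1))"
    by (intro has_bochner_integral_add has_bochner_integral_mult_right m0 m1 m2)
  then show "has_bochner_integral lborel (\<lambda>t. t\<^sup>2 * ?n t) (s\<^sup>2 + 1)"
    by (simp add: algebra_simps power2_eq_square)
  have "has_bochner_integral lborel (\<lambda>t. ?n t * (t - s) ^ 3 + ((3 * s) * (?n t * (t - s)\<^sup>2) +
      ((3 * s\<^sup>2) * (?n t * (t - s)) + s ^ 3 * ?n t))) (0 + ((3 * s) * 1 + ((3 * s\<^sup>2) * 0 + s ^ 3 * 1)))"
    by (intro has_bochner_integral_add has_bochner_integral_mult_right m0 m1 m2 m3)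
  then show "has_bochner_integral lborel (\<lambda>t. t ^ 3 * ?n t) (s ^ 3 + 3 * s)"
    by (simp add: algebra_simps power2_eq_square power3_eq_cube)
qed

text \<open>\<open>H\<close> is the \<open>k\<close>-th probabilists' Hermite polynomial. It undoes
  the convolution with the standard normal law, so integrating it against a mixture returns the
  \<open>k\<close>-th moment of the mixing law exactly.\<close>

lemma normal_density_hermite:
  assumes "k \<in> {1, 2, 3}"
  defines "H \<equiv> (\<lambda>t :: real. if k = 1 then t else if k = 2 then t\<^sup>2 - 1 else t ^ 3 - 3 * t)"
  shows "has_bochner_integral lborel (\<lambda>t. H t * normal_density s 1 t) (s ^ k)"
proof -
  let ?n = "normal_density s 1"
  have m0: "has_bochner_integral lborel ?n 1"
    by (simp add: has_bochner_integral_iff)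
  have "has_bochner_integral lborel (\<lambda>t. t\<^sup>2 * ?n t - ?n t) ((s\<^sup>2 + 1) - 1)"
    by (intro has_bochner_integral_diff normal_density_moments m0)
  moreover have "has_bochner_integral lborel (\<lambda>t. t ^ 3 * ?n t - 3 * (t * ?n t)) ((s ^ 3 + 3 * s) - 3 * s)"
    by (intro has_bochner_integral_diff has_bochner_integral_mult_right normal_density_moments)
  ultimately show ?thesis
    using assms normal_density_moments(1)[of s] by (auto simp: H_def algebra_simps)
qed

text \<open>A single term of the exponential series gives
  \<open>\<bar>t\<bar> ^ k \<le> fact k * exp \<bar>t\<bar>\<close>. The cubic is the worst case,
  with \<open>9 = 6 + 3\<close>.\<close>

lemma hermite_exp_bound:
  fixes t :: real
  shows "\<bar>t\<bar> \<le> 9 * exp \<bar>t\<bar>" "\<bar>t\<^sup>2 - 1\<bar> \<le> 9 * exp \<bar>t\<bar>" "\<bar>t ^ 3 - 3 * t\<bar> \<le> 9 * exp \<bar>t\<bar>"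
proof -
  have pow: "\<bar>t\<bar> ^ k \<le> fact k * exp \<bar>t\<bar>" for k
  proof -
    have "(\<Sum>i\<in>{k}. \<bar>t\<bar> ^ i /\<^sub>R fact i) \<le> exp \<bar>t\<bar>"
      using sums_unique[OF exp_converges[of "\<bar>t\<bar>"]] sums_summable[OF exp_converges[of "\<bar>t\<bar>"]]
      by (simp only:) (intro sum_le_suminf; simp)
    then show ?thesis by (simp add: field_simps)
  qed
  have t: "\<bar>t\<bar> \<le> exp \<bar>t\<bar>" "t\<^sup>2 \<le> 2 * exp \<bar>t\<bar>" "\<bar>t ^ 3\<bar> \<le> 6 * exp \<bar>t\<bar>" "1 \<le> exp \<bar>t\<bar>"
    using pow[of 1] pow[of 2] pow[of 3] by (simp_all add: fact_numeral power_abs)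
  show "\<bar>t\<bar> \<le> 9 * exp \<bar>t\<bar>" using t by linarith
  show "\<bar>t\<^sup>2 - 1\<bar> \<le> 9 * exp \<bar>t\<bar>" using t zero_le_power2[of t] by linarith
  show "\<bar>t ^ 3 - 3 * t\<bar> \<le> 9 * exp \<bar>t\<bar>" using t by linarith
qed

text \<open>Quantitative identifiability: \<open>hellinger_integral_diff\<close> with the Hermite
  polynomials as test functions. Here \<open>B = 81 * 4 * exp (2 * b + 2)\<close>, and
  \<open>2 * sqrt B = 36 * exp (b + 1)\<close>.\<close>

lemma moment_gap_hellinger:
  assumes b: "0 \<le> b" and x: "\<bar>x\<bar> \<le> b" and y: "\<bar>y\<bar> \<le> b" and z: "\<bar>z\<bar> \<le> b" and u: "\<bar>u\<bar> \<le> b"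
    and w: "0 \<le> w" "w \<le> 1" and v: "0 \<le> v" "v \<le> 1" and k: "k \<in> {1, 2, 3}"
  shows "\<bar>moment_gap w x y v z u k\<bar>
    \<le> 36 * exp (b + 1) * hellinger (normal_mixture w x y) (normal_mixture v z u)"
proof -
  define H where "H = (\<lambda>t :: real. if k = 1 then t else if k = 2 then t\<^sup>2 - 1 else t ^ 3 - 3 * t)"
  define f where "f = normal_mixture w x y"
  define g where "g = normal_mixture v z u"
  have fg: "f \<in> normal_mixtures b" "g \<in> normal_mixtures b"
    unfolding f_def g_def normal_mixtures_def using x y z u w v by blast+
  note pd = fg[THEN normal_mixture_prob_density]
  have [measurable]: "f \<in> borel_measurable borel" "g \<in> borel_measurable borel"
    using pd by (auto simp: prob_density_def)
  have H_mix: "has_bochner_integral lborel (\<lambda>t. H t * normal_mixture q r s t) (two_point q r s (\<lambda>s. s ^ k))"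
    for q r s
  proof -
    have "has_bochner_integral lborel
        (\<lambda>t. q * (H t * normal_density r 1 t) + (1 - q) * (H t * normal_density s 1 t))
        (q * r ^ k + (1 - q) * s ^ k)"
      unfolding H_def
      by (intro has_bochner_integral_add has_bochner_integral_mult_right normal_density_hermite k)
    then show ?thesis by (simp add: two_point_def algebra_simps)
  qed
  have Hb: "\<bar>H t\<bar> \<le> 9 * exp \<bar>t\<bar>" for t
    unfolding H_def using hermite_exp_bound[of t] by auto
  have "(\<integral>\<^sup>+t. ennreal ((H t)\<^sup>2 * (f t + g t)) \<partial>lborel)
      \<le> (\<integral>\<^sup>+t. ennreal 81 * (ennreal (exp (2 * \<bar>t\<bar>) * f t) + ennreal (exp (2 * \<bar>t\<bar>) * g t)) \<partial>lborel)"
  proof (intro nn_integral_mono)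
    fix t
    have nn: "0 \<le> f t" "0 \<le> g t" using pd by (auto simp: prob_density_def)
    have "(H t)\<^sup>2 \<le> (9 * exp \<bar>t\<bar>)\<^sup>2" by (rule power2_le_iff_abs_le[THEN iffD2]) (use Hb in auto)
    also have "\<dots> = 81 * exp (2 * \<bar>t\<bar>)" by (simp add: power_mult_distrib flip: exp_double)
    finally have "(H t)\<^sup>2 * (f t + g t) \<le> 81 * exp (2 * \<bar>t\<bar>) * (f t + g t)"
      using nn by (intro mult_right_mono) auto
    also have "\<dots> = 81 * (exp (2 * \<bar>t\<bar>) * f t + exp (2 * \<bar>t\<bar>) * g t)" by (simp add: algebra_simps)
    finally show "ennreal ((H t)\<^sup>2 * (f t + g t)) \<le>
        ennreal 81 * (ennreal (exp (2 * \<bar>t\<bar>) * f t) + ennreal (exp (2 * \<bar>t\<bar>) * g t))"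
      using nn by (simp add: ennreal_leI flip: ennreal_mult ennreal_plus del: ennreal_numeral)
  qed
  also have "\<dots> = ennreal 81 * ((\<integral>\<^sup>+t. ennreal (exp (2 * \<bar>t\<bar>) * f t) \<partial>lborel) +
      (\<integral>\<^sup>+t. ennreal (exp (2 * \<bar>t\<bar>) * g t) \<partial>lborel))"
    by (subst nn_integral_cmult) (auto simp: nn_integral_add)
  also have "\<dots> \<le> ennreal 81 * (ennreal (2 * exp (2 * b + 2\<^sup>2 / 2)) + ennreal (2 * exp (2 * b + 2\<^sup>2 / 2)))"
    by (intro mult_left_mono add_mono normal_mixture_exp_moment fg) auto
  also have "\<dots> = ennreal (324 * exp (2 * (b + 1)))"
    by (simp add: algebra_simps flip: ennreal_mult ennreal_plus ennreal_numeral)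
  finally have "\<bar>(\<integral>t. H t * f t \<partial>lborel) - (\<integral>t. H t * g t \<partial>lborel)\<bar>
      \<le> 2 * sqrt (324 * exp (2 * (b + 1))) * hellinger f g"
    using H_mix[of w x y] H_mix[of v z u]
    by (intro hellinger_integral_diff pd) (auto simp: f_def g_def has_bochner_integral_iff H_def)
  moreover have "sqrt (324 * exp (2 * (b + 1))) = 18 * exp (b + 1)"
    by (rule real_sqrt_unique) (auto simp: power_mult_distrib simp flip: exp_double)
  ultimately show ?thesis
    using H_mix[of w x y] H_mix[of v z u]
    by (simp add: f_def g_def has_bochner_integral_iff moment_gap_def)
qed

lemma sqrt_likelihood_ratio_deriv:
  assumes b: "0 \<le> b"
  obtains C L where "0 \<le> C" "0 \<le> L"
    "\<And>f g. f \<in> normal_mixtures b \<Longrightarrow> g \<in> normal_mixtures b \<Longrightarrow>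
      \<exists>s'. (\<forall>t. ((\<lambda>t. sqrt (f t / g t)) has_real_derivative s' t) (at t)) \<and>
        continuous_on UNIV s' \<and> (\<forall>t. \<bar>s' t\<bar> \<le> hellinger f g * C * exp (L * \<bar>t\<bar>))"
proof -
  define K where "K = 4 * (1 + b)"
  define C0 where "C0 = K * (1 + b) * exp (K\<^sup>2 / 2 + b\<^sup>2)"
  have C0: "0 \<le> C0" using b by (simp add: C0_def K_def)
  show thesis
  proof (rule that)
    \<comment> \<open>\<open>108 = 3 * 36\<close>, one summand for each of the three moment
      gaps.\<close>
    show "0 \<le> 108 * exp (b + 1) * C0" using C0 by simp
    show "0 \<le> K + 3 * b" using b by (simp add: K_def)
    fix f g assume "f \<in> normal_mixtures b" "g \<in> normal_mixtures b"
    then obtain w x y v z u where f: "f = normal_mixture w x y" and g: "g = normal_mixture v z u"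
      and w: "0 \<le> w" "w \<le> 1" and v: "0 \<le> v" "v \<le> 1"
      and xy: "\<bar>x\<bar> \<le> b" "\<bar>y\<bar> \<le> b" and zu: "\<bar>z\<bar> \<le> b" "\<bar>u\<bar> \<le> b"
      unfolding normal_mixtures_def by blast
    let ?D = "moment_gap w x y v z u"
    have D: "\<bar>?D 1\<bar> + \<bar>?D 2\<bar> + \<bar>?D 3\<bar> \<le> hellinger f g * (108 * exp (b + 1))"
      using moment_gap_hellinger[OF b xy zu w v, of 1] moment_gap_hellinger[OF b xy zu w v, of 2]
        moment_gap_hellinger[OF b xy zu w v, of 3] by (simp add: f g algebra_simps)
    obtain s' where s': "\<And>t. ((\<lambda>t. sqrt (f t / g t)) has_real_derivative s' t) (at t)"
        "continuous_on UNIV s'"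
        "\<And>t. \<bar>s' t\<bar> \<le> (\<bar>?D 1\<bar> + \<bar>?D 2\<bar> + \<bar>?D 3\<bar>) * C0 * exp ((K + 3 * b) * \<bar>t\<bar>)"
      using sqrt_mixture_ratio_deriv[OF b xy zu w v] unfolding f g K_def C0_def by blast
    have "\<bar>s' t\<bar> \<le> hellinger f g * (108 * exp (b + 1) * C0) * exp ((K + 3 * b) * \<bar>t\<bar>)" for t
    proof -
      have "\<bar>s' t\<bar> \<le> hellinger f g * (108 * exp (b + 1)) * C0 * exp ((K + 3 * b) * \<bar>t\<bar>)"
        using s'(3)[of t] mult_right_mono[OF mult_right_mono[OF D C0], of "exp ((K + 3 * b) * \<bar>t\<bar>)"]
        by simp
      then show ?thesis by (simp add: mult.assoc)
    qed
    with s' show "\<exists>s'. (\<forall>t. ((\<lambda>t. sqrt (f t / g t)) has_real_derivative s' t) (at t)) \<and>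
        continuous_on UNIV s' \<and>
        (\<forall>t. \<bar>s' t\<bar> \<le> hellinger f g * (108 * exp (b + 1) * C0) * exp ((K + 3 * b) * \<bar>t\<bar>))"
      by blast
  qed
qed

section \<open>Empirical averages of differentiable functions\<close>

text \<open>
  A differentiable \<open>g\<close> satisfies \<open>g x = g 0 + \<integral> g' t * level x t dt\<close>, which reduces empirical
  averages of arbitrary \<open>g\<close> to those of the functions \<open>\<lambda>x. level x t\<close>.
\<close>

definition level :: "real \<Rightarrow> real \<Rightarrow> real" where
  "level x t = (if 0 \<le> t \<and> t \<le> x then 1 else 0) - (if x \<le> t \<and> t \<le> 0 then 1 else 0)"

lemma level_measurable [measurable (raw)]:
  assumes [measurable]: "f \<in> borel_measurable M" "g \<in> borel_measurable M"
  shows "(\<lambda>x. level (f x) (g x)) \<in> borel_measurable M"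
  unfolding level_def by measurable

lemma level_abs_le_1: "\<bar>level x t\<bar> \<le> 1"
  unfolding level_def by auto

text \<open>\<open>level x\<close> vanishes outside
  \<open>\<bar>t\<bar> \<le> \<bar>x\<bar>\<close>. As in Chernoff's bound, an exponential moment of
  \<open>x\<close> is thereby traded for decay in \<open>t\<close>.\<close>

lemma level_abs_le_exp:
  assumes "0 \<le> c"
  shows "\<bar>level x t\<bar> \<le> exp (c * \<bar>x\<bar>) * exp (- c * \<bar>t\<bar>)"
proof (cases "\<bar>t\<bar> \<le> \<bar>x\<bar>")
  case True
  then have "1 \<le> exp (c * \<bar>x\<bar>) * exp (- c * \<bar>t\<bar>)"
    using assms by (simp add: mult_exp_exp mult_left_mono)
  then show ?thesis using level_abs_le_1 order_trans by blast
next
  case False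
  then have "level x t = 0" unfolding level_def by auto
  then show ?thesis by simp
qed

lemma has_bochner_integral_deriv_level:
  assumes deriv: "\<And>t. (g has_real_derivative g' t) (at t)" and cont: "continuous_on UNIV g'"
  shows "has_bochner_integral lborel (\<lambda>t. g' t * level x t) (g x - g 0)"
proof -
  have icc: "has_bochner_integral lborel (\<lambda>t. g' t * indicator {p..q} t) (g q - g p)"
    if "p \<le> q" for p q
    using that deriv cont
    by (intro has_bochner_integral_FTC_Icc_real) (auto simp: continuous_on_eq_continuous_at)
  consider "x = 0" | "0 < x" | "x < 0" by linarith
  then show ?thesis
  proof cases
    case 1
    \<comment> \<open>At \<open>t = 0\<close> both indicators equal one and cancel.\<close>
    have "level 0 t = 0" for t by (simp add: level_def)
    then show ?thesis using 1 by (simp add: has_bochner_integral_zero)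
  next
    case 2
    have "level x t = indicator {0..x} t" for t using 2 by (auto simp: level_def indicator_def)
    then show ?thesis using icc[of 0 x] 2 by simp
  next
    case 3
    have "level x t = - indicator {x..0} t" for t using 3 by (auto simp: level_def indicator_def)
    then show ?thesis using has_bochner_integral_minus[OF icc[of x 0]] 3 by simp
  qed
qed

text \<open>This is the Laplace density of mass one. It is the margin between the rates used below:
  \<open>2 * L\<close> and \<open>2 * L + 2\<close> in the Cauchy-Schwarz splitting,
  \<open>2 * L + 2\<close> and \<open>2 * L + 4\<close> in the mean of the energy.\<close>

lemma nn_integral_exp_abs_le: "(\<integral>\<^sup>+t. ennreal (exp (- 2 * \<bar>t\<bar>)) \<partial>lborel) \<le> 1"
proof -
  let ?e = "\<lambda>t. ennreal (exponential_density 2 t)"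
  have e: "(\<integral>\<^sup>+t. ?e t \<partial>lborel) = 1"
    using prob_space.emeasure_space_1[OF prob_space_exponential_density[of 2]]
    by (simp add: emeasure_density)
  then have e': "(\<integral>\<^sup>+t. ?e (- t) \<partial>lborel) = 1"
    by (subst (asm) nn_integral_real_affine[where c="-1" and t=0]) auto
  have "(\<integral>\<^sup>+t. ennreal (exp (- 2 * \<bar>t\<bar>)) \<partial>lborel) \<le>
      (\<integral>\<^sup>+t. ennreal (1 / 2) * (?e t + ?e (- t)) \<partial>lborel)"
  proof (rule nn_integral_mono)
    fix t :: real
    \<comment> \<open>An equality except at \<open>t = 0\<close>, where both one-sided densities
      contribute.\<close>
    have "exp (- 2 * \<bar>t\<bar>) \<le> 1 / 2 * (exponential_density 2 t + exponential_density 2 (- t))"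
      by (auto simp: exponential_density_def mult.commute)
    then have "ennreal (exp (- 2 * \<bar>t\<bar>))
        \<le> ennreal (1 / 2 * (exponential_density 2 t + exponential_density 2 (- t)))"
      by (rule ennreal_leI)
    also have "\<dots> = ennreal (1 / 2) * (?e t + ?e (- t))"
      by (subst ennreal_mult; (subst ennreal_plus)?) (simp_all add: exponential_density_nonneg)
    finally show "ennreal (exp (- 2 * \<bar>t\<bar>)) \<le> ennreal (1 / 2) * (?e t + ?e (- t))" .
  qed
  also have "\<dots> = ennreal (1 / 2) * ennreal 2"
    by (simp add: nn_integral_cmult nn_integral_add e e')
  also have "\<dots> = ennreal (1 / 2 * 2)" by (rule ennreal_mult[symmetric]) auto
  finally show ?thesis by simp
qed

text \<open>The variance of a sum of independent centred variables: expand the square, and the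
  off-diagonal products integrate to zero.\<close>

lemma (in prob_space) nn_integral_sum_square_PiM:
  fixes f :: "'a \<Rightarrow> real"
  assumes [measurable]: "f \<in> borel_measurable M" and bd: "\<And>x. \<bar>f x\<bar> \<le> c" and mean: "expectation f = 0"
    and I: "finite I"
  shows "(\<integral>\<^sup>+x. ennreal ((\<Sum>i\<in>I. f (x i))\<^sup>2) \<partial>Pi\<^sub>M I (\<lambda>_. M)) = ennreal (real (card I) * expectation (\<lambda>x. (f x)\<^sup>2))"
proof -
  interpret P: product_prob_space "\<lambda>_. M" I
    by unfold_locales
  have c0: "0 \<le> c" using bd[of undefined] by linarith
  have int_f: "integrable M f"
    by (rule integrable_const_bound[where B=c]) (use bd in auto)
  have int_f2: "integrable M (\<lambda>x. (f x)\<^sup>2)"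
  proof (rule integrable_const_bound[where B="c\<^sup>2"])
    show "AE x in M. norm ((f x)\<^sup>2) \<le> c\<^sup>2"
      using bd c0 by (auto simp: abs_le_square_iff[symmetric])
  qed measurable
  have cross: "has_bochner_integral (Pi\<^sub>M I (\<lambda>_. M)) (\<lambda>x. f (x i) * f (x j))
      (if i = j then expectation (\<lambda>x. (f x)\<^sup>2) else 0)" if ij: "i \<in> I" "j \<in> I" for i j
  proof -
    \<comment> \<open>This writes \<open>f (x i) * f (x j)\<close> as a product over all
      coordinates; for \<open>i = j\<close> the factor at \<open>i\<close> becomes the square, so
      one product formula serves both cases.\<close>
    let ?h = "\<lambda>k y. (if k = i then f y else 1) * (if k = j then f y else 1)"
    have eq: "(\<Prod>k\<in>I. ?h k (x k)) = f (x i) * f (x j)" for x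
      using ij I by (simp add: prod.distrib)
    have int_h: "integrable M (?h k)" for k
      using int_f int_f2 by (cases "k = i"; cases "k = j") (auto simp: power2_eq_square)
    have "has_bochner_integral (Pi\<^sub>M I (\<lambda>_. M)) (\<lambda>x. f (x i) * f (x j)) (\<Prod>k\<in>I. expectation (?h k))"
      using P.product_integrable_prod[OF I, of ?h] P.product_integral_prod[OF I, of ?h] int_h
      unfolding eq by (simp add: has_bochner_integral_iff)
    moreover have "(\<Prod>k\<in>I. expectation (?h k)) = (if i = j then expectation (\<lambda>x. (f x)\<^sup>2) else 0)"
    proof (cases "i = j")
      case True
      then have "expectation (?h k) = (if k = j then expectation (\<lambda>x. (f x)\<^sup>2) else 1)" for k
        by (simp add: power2_eq_square prob_space)
      then show ?thesis using True ij I by simp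
    next
      case False
      then have "expectation (?h i) = 0" using mean by simp
      then have "(\<Prod>k\<in>I. expectation (?h k)) = 0" by (intro prod_zero I bexI[OF _ ij(1)])
      then show ?thesis using False by simp
    qed
    ultimately show ?thesis by simp
  qed
  have "has_bochner_integral (Pi\<^sub>M I (\<lambda>_. M)) (\<lambda>x. \<Sum>i\<in>I. \<Sum>j\<in>I. f (x i) * f (x j))
      (\<Sum>i\<in>I. \<Sum>j\<in>I. if i = j then expectation (\<lambda>x. (f x)\<^sup>2) else 0)"
    by (intro has_bochner_integral_sum cross)
  then have "has_bochner_integral (Pi\<^sub>M I (\<lambda>_. M)) (\<lambda>x. (\<Sum>i\<in>I. f (x i))\<^sup>2)
      (real (card I) * expectation (\<lambda>x. (f x)\<^sup>2))"
    using I by (simp add: power2_eq_square sum_product)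
  then show ?thesis
    by (subst nn_integral_eq_integral) (auto simp: has_bochner_integral_iff)
qed

section \<open>The empirical process under a fixed law\<close>

context real_distribution
begin

definition level_mean :: "real \<Rightarrow> real" where
  "level_mean t = expectation (\<lambda>x. level x t)"

text \<open>For almost every \<open>t\<close> this is minus \<open>card I\<close> times the centred
  empirical distribution function. Splitting at zero (points above a positive \<open>t\<close>,
  points below a negative one) makes the uncentred summands decay in both tails.\<close>

definition level_sum :: "'i set \<Rightarrow> ('i \<Rightarrow> real) \<Rightarrow> real \<Rightarrow> real" where
  "level_sum I x t = (\<Sum>i\<in>I. level (x i) t - level_mean t)"

text \<open>By Cauchy-Schwarz with weight \<open>exp (- 2 * \<bar>t\<bar>)\<close>, this dominates
  the squared centred sum of every \<open>g\<close> whose derivative is at most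
  \<open>exp (L * \<bar>t\<bar>)\<close>.\<close>

definition level_energy :: "real \<Rightarrow> 'i set \<Rightarrow> ('i \<Rightarrow> real) \<Rightarrow> ennreal" where
  "level_energy L I x = (\<integral>\<^sup>+t. ennreal (exp ((2 * L + 2) * \<bar>t\<bar>) * (level_sum I x t)\<^sup>2) \<partial>lborel)"

lemma level_mean_measurable [measurable]: "level_mean \<in> borel_measurable borel"
  unfolding level_mean_def by measurable

lemma level_sum_measurable:
  assumes "finite I"
  shows "(\<lambda>(x, t). level_sum I x t) \<in> borel_measurable (Pi\<^sub>M I (\<lambda>_. M) \<Otimes>\<^sub>M borel)"
  unfolding level_sum_def split_beta by measurable

text \<open>The variance of one summand is at most its second moment, and
  \<open>(level x t)\<^sup>2 \<le> \<bar>level x t\<bar>\<close> is bounded by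
  \<open>level_abs_le_exp\<close>.\<close>

lemma level_sum_variance:
  assumes I: "finite I" and c: "0 \<le> c"
    and B: "(\<integral>\<^sup>+x. ennreal (exp (c * \<bar>x\<bar>)) \<partial>M) \<le> ennreal B"
  shows "(\<integral>\<^sup>+x. ennreal ((level_sum I x t)\<^sup>2) \<partial>Pi\<^sub>M I (\<lambda>_. M))
    \<le> ennreal (real (card I) * exp (- c * \<bar>t\<bar>)) * ennreal B"
proof -
  have int: "integrable M (\<lambda>x. level x t)" "integrable M (\<lambda>x. (level x t)\<^sup>2)"
    using level_abs_le_1[of _ t]
    by (auto intro!: integrable_const_bound[where B=1] simp: abs_square_le_1)
  have mean_le: "\<bar>level_mean t\<bar> \<le> 1"
  proof -
    have "\<bar>level_mean t\<bar> \<le> expectation (\<lambda>x. \<bar>level x t\<bar>)"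
      unfolding level_mean_def using integral_norm_bound[of M "\<lambda>x. level x t"] by simp
    also have "\<dots> \<le> expectation (\<lambda>x. 1)"
      using int level_abs_le_1 by (intro integral_mono) auto
    finally show ?thesis using prob_space by simp
  qed
  have "(\<integral>\<^sup>+x. ennreal ((level_sum I x t)\<^sup>2) \<partial>Pi\<^sub>M I (\<lambda>_. M)) =
      ennreal (real (card I) * expectation (\<lambda>x. (level x t - level_mean t)\<^sup>2))"
    unfolding level_sum_def
  proof (rule nn_integral_sum_square_PiM[where c=2, OF _ _ _ I])
    show "\<bar>level x t - level_mean t\<bar> \<le> 2" for x
      using level_abs_le_1[of x t] mean_le by linarith
    show "expectation (\<lambda>x. level x t - level_mean t) = 0"
      using int prob_space by (simp add: level_mean_def)
  qed measurable
  also have "\<dots> \<le> ennreal (real (card I) * expectation (\<lambda>x. (level x t)\<^sup>2))"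
    using int unfolding level_mean_def
    by (intro ennreal_leI mult_left_mono; (subst variance_eq)?) auto
  also have "ennreal (real (card I) * expectation (\<lambda>x. (level x t)\<^sup>2)) =
      ennreal (real (card I)) * (\<integral>\<^sup>+x. ennreal ((level x t)\<^sup>2) \<partial>M)"
    using int by (subst nn_integral_eq_integral) (auto simp: ennreal_mult)
  also have "(\<integral>\<^sup>+x. ennreal ((level x t)\<^sup>2) \<partial>M) \<le> (\<integral>\<^sup>+x. ennreal (exp (- c * \<bar>t\<bar>)) * ennreal (exp (c * \<bar>x\<bar>)) \<partial>M)"
  proof (rule nn_integral_mono)
    fix x
    have "(level x t)\<^sup>2 = \<bar>level x t\<bar> * \<bar>level x t\<bar>"
      by (simp add: power2_eq_square)
    also have "\<dots> \<le> \<bar>level x t\<bar> * 1"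
      by (intro mult_left_mono level_abs_le_1) auto
    also have "\<dots> \<le> exp (- c * \<bar>t\<bar>) * exp (c * \<bar>x\<bar>)"
      using level_abs_le_exp[OF c, of x t] by (simp add: mult.commute)
    finally show "ennreal ((level x t)\<^sup>2) \<le> ennreal (exp (- c * \<bar>t\<bar>)) * ennreal (exp (c * \<bar>x\<bar>))"
      by (simp add: ennreal_leI flip: ennreal_mult)
  qed
  also have "\<dots> = ennreal (exp (- c * \<bar>t\<bar>)) * (\<integral>\<^sup>+x. ennreal (exp (c * \<bar>x\<bar>)) \<partial>M)"
    by (rule nn_integral_cmult) measurable
  also have "\<dots> \<le> ennreal (exp (- c * \<bar>t\<bar>)) * ennreal B"
    by (intro mult_left_mono B) auto
  finally show ?thesis
    by (simp add: mult_left_mono ennreal_mult mult.assoc)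
qed

text \<open>Tonelli reduces this to the variance at each \<open>t\<close>, whose decay
  \<open>exp (- (2 * L + 4) * \<bar>t\<bar>)\<close> beats the weight and leaves
  \<open>exp (- 2 * \<bar>t\<bar>)\<close>.\<close>

lemma level_energy_expectation:
  assumes I: "finite I" and L: "0 \<le> L"
    and B: "(\<integral>\<^sup>+x. ennreal (exp ((2 * L + 4) * \<bar>x\<bar>)) \<partial>M) \<le> ennreal B"
  shows "(\<integral>\<^sup>+x. level_energy L I x \<partial>Pi\<^sub>M I (\<lambda>_. M)) \<le> ennreal (real (card I)) * ennreal B"
proof -
  interpret P: product_prob_space "\<lambda>_. M" I
    by unfold_locales
  interpret pair_sigma_finite "Pi\<^sub>M I (\<lambda>_. M)" lborel
    by unfold_locales
  note level_sum_measurable[OF I, measurable]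
  have [measurable]: "(\<lambda>x. level_sum I x t) \<in> borel_measurable (Pi\<^sub>M I (\<lambda>_. M))" for t
    unfolding level_sum_def by measurable
  have "(\<integral>\<^sup>+x. level_energy L I x \<partial>Pi\<^sub>M I (\<lambda>_. M)) =
      (\<integral>\<^sup>+t. \<integral>\<^sup>+x. ennreal (exp ((2 * L + 2) * \<bar>t\<bar>) * (level_sum I x t)\<^sup>2) \<partial>Pi\<^sub>M I (\<lambda>_. M) \<partial>lborel)"
    unfolding level_energy_def
    by (rule Fubini'[symmetric]) measurable
  also have "\<dots> \<le> (\<integral>\<^sup>+t. ennreal (real (card I)) * ennreal B * ennreal (exp (- 2 * \<bar>t\<bar>)) \<partial>lborel)"
  proof (rule nn_integral_mono)
    fix t :: real
    let ?c = "2 * L + 4" and ?e = "exp ((2 * L + 2) * \<bar>t\<bar>)"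
    have "(\<integral>\<^sup>+x. ennreal (?e * (level_sum I x t)\<^sup>2) \<partial>Pi\<^sub>M I (\<lambda>_. M)) =
        ennreal ?e * (\<integral>\<^sup>+x. ennreal ((level_sum I x t)\<^sup>2) \<partial>Pi\<^sub>M I (\<lambda>_. M))"
      by (simp add: ennreal_mult nn_integral_cmult)
    also have "\<dots> \<le> ennreal ?e * (ennreal (real (card I) * exp (- ?c * \<bar>t\<bar>)) * ennreal B)"
      using L by (intro mult_left_mono level_sum_variance I B) auto
    also have "\<dots> = ennreal (real (card I)) * ennreal B * ennreal (?e * exp (- ?c * \<bar>t\<bar>))"
      by (simp add: ennreal_mult mult_ac)
    also have "?e * exp (- ?c * \<bar>t\<bar>) = exp (- 2 * \<bar>t\<bar>)"
      by (simp add: mult_exp_exp algebra_simps)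
    finally show "(\<integral>\<^sup>+x. ennreal (?e * (level_sum I x t)\<^sup>2) \<partial>Pi\<^sub>M I (\<lambda>_. M))
        \<le> ennreal (real (card I)) * ennreal B * ennreal (exp (- 2 * \<bar>t\<bar>))" .
  qed
  also have "\<dots> = ennreal (real (card I)) * ennreal B * (\<integral>\<^sup>+t. ennreal (exp (- 2 * \<bar>t\<bar>)) \<partial>lborel)"
    by (rule nn_integral_cmult) measurable
  also have "\<dots> \<le> ennreal (real (card I)) * ennreal B * 1"
    by (intro mult_left_mono nn_integral_exp_abs_le) auto
  finally show ?thesis by simp
qed

text \<open>Averaging \<open>g x - g 0 = \<integral> g' t * level x t dt\<close> over
  \<open>x\<close> and exchanging the integrals gives the same formula for the mean of
  \<open>g\<close>; subtracting the two cancels \<open>g 0\<close>.\<close>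

lemma centered_deriv_level:
  assumes deriv: "\<And>t. (g has_real_derivative g' t) (at t)" and cont: "continuous_on UNIV g'"
    and g': "\<And>t. \<bar>g' t\<bar> \<le> c * exp (L * \<bar>t\<bar>)" and L: "0 \<le> L"
    and B: "(\<integral>\<^sup>+x. ennreal (exp ((2 * L + 4) * \<bar>x\<bar>)) \<partial>M) \<le> ennreal B"
  shows "has_bochner_integral lborel (\<lambda>t. g' t * (level x t - level_mean t)) (g x - expectation g)"
proof -
  interpret pair_sigma_finite M lborel
    by unfold_locales
  have c0: "0 \<le> c" using g'[of 0] by simp
  have [measurable]: "g' \<in> borel_measurable borel"
    using cont by (rule borel_measurable_continuous_onI)
  have [measurable]: "g \<in> borel_measurable borel"
    using deriv by (intro borel_measurable_continuous_onI)
      (auto simp: continuous_on_eq_continuous_at intro: DERIV_isCont)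
  let ?F = "\<lambda>x t. g' t * level x t"
  have F_bound: "\<bar>?F x t\<bar> \<le> c * exp ((2 * L + 4) * \<bar>x\<bar>) * exp (- 2 * \<bar>t\<bar>)" for x t
  proof -
    have "\<bar>?F x t\<bar> \<le> (c * exp (L * \<bar>t\<bar>)) * (exp ((2 * L + 4) * \<bar>x\<bar>) * exp (- (2 * L + 4) * \<bar>t\<bar>))"
      unfolding abs_mult using g'[of t] c0 L by (intro mult_mono level_abs_le_exp) auto
    also have "\<dots> = c * exp ((2 * L + 4) * \<bar>x\<bar>) * exp (- (L + 4) * \<bar>t\<bar>)"
      by (simp add: mult_exp_exp algebra_simps)
    also have "\<dots> \<le> c * exp ((2 * L + 4) * \<bar>x\<bar>) * exp (- 2 * \<bar>t\<bar>)"
    proof -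
      have "- (L + 4) * \<bar>t\<bar> \<le> - 2 * \<bar>t\<bar>" using L by (intro mult_right_mono) auto
      then show ?thesis using c0 by (intro mult_left_mono) auto
    qed
    finally show ?thesis .
  qed
  have "integrable (M \<Otimes>\<^sub>M lborel) (case_prod ?F)"
    unfolding integrable_iff_bounded
  proof
    show [measurable]: "case_prod ?F \<in> borel_measurable (M \<Otimes>\<^sub>M lborel)"
      by measurable
    have "(\<integral>\<^sup>+z. ennreal (norm (case_prod ?F z)) \<partial>(M \<Otimes>\<^sub>M lborel)) =
        (\<integral>\<^sup>+x. \<integral>\<^sup>+t. ennreal \<bar>?F x t\<bar> \<partial>lborel \<partial>M)"
      by (subst lborel.nn_integral_fst[symmetric]) auto
    also have "\<dots> \<le> (\<integral>\<^sup>+x. \<integral>\<^sup>+t. ennreal (c * exp ((2 * L + 4) * \<bar>x\<bar>)) * ennreal (exp (- 2 * \<bar>t\<bar>)) \<partial>lborel \<partial>M)"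
      using F_bound c0 by (intro nn_integral_mono) (simp add: ennreal_leI flip: ennreal_mult)
    also have "\<dots> = (\<integral>\<^sup>+x. ennreal (c * exp ((2 * L + 4) * \<bar>x\<bar>)) * (\<integral>\<^sup>+t. ennreal (exp (- 2 * \<bar>t\<bar>)) \<partial>lborel) \<partial>M)"
      by (intro nn_integral_cong nn_integral_cmult) measurable
    also have "\<dots> \<le> (\<integral>\<^sup>+x. ennreal (c * exp ((2 * L + 4) * \<bar>x\<bar>)) * 1 \<partial>M)"
      by (intro nn_integral_mono mult_left_mono nn_integral_exp_abs_le) auto
    also have "\<dots> = ennreal c * (\<integral>\<^sup>+x. ennreal (exp ((2 * L + 4) * \<bar>x\<bar>)) \<partial>M)"
      using c0 by (subst nn_integral_cmult[symmetric]) (auto simp: ennreal_mult)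
    also have "\<dots> \<le> ennreal c * ennreal B" by (intro mult_left_mono B) auto
    also have "\<dots> < \<infinity>" by (simp add: ennreal_mult_less_top)
    finally show "(\<integral>\<^sup>+z. ennreal (norm (case_prod ?F z)) \<partial>(M \<Otimes>\<^sub>M lborel)) < \<infinity>" .
  qed
  note F = this
  have gx: "has_bochner_integral lborel (?F x) (g x - g 0)" for x
    by (rule has_bochner_integral_deriv_level[OF deriv cont])
  have Fx: "(\<integral>t. ?F x t \<partial>lborel) = g x - g 0" for x
    using gx[of x] by (simp add: has_bochner_integral_iff)
  \<comment> \<open>Integrability of \<open>g\<close> is not assumed; it is a by-product of
    Fubini.\<close>
  have "integrable M (\<lambda>x. g x - g 0)"
    using integrable_fst[OF F] unfolding Fx .
  then have "integrable M (\<lambda>x. (g x - g 0) + g 0)" by (intro Bochner_Integration.integrable_add) auto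
  then have int_g: "integrable M g" by simp
  have mean: "(\<integral>x. ?F x t \<partial>M) = g' t * level_mean t" for t
    by (simp add: level_mean_def)
  have "integrable lborel (\<lambda>t. g' t * level_mean t)"
    using integrable_snd[OF F] unfolding mean .
  moreover have "(\<integral>t. g' t * level_mean t \<partial>lborel) = expectation g - g 0"
    using Fubini_integral[OF F] int_g prob_space unfolding mean Fx by simp
  ultimately have "has_bochner_integral lborel (\<lambda>t. g' t * level_mean t) (expectation g - g 0)"
    by (simp add: has_bochner_integral_iff)
  from has_bochner_integral_diff[OF gx[of x] this] show ?thesis
    by (simp add: algebra_simps)
qed

text \<open>The product is split pointwise by
  \<open>2 * p * q \<le> n * p\<^sup>2 + q\<^sup>2 / n\<close>. The term
  \<open>n * h\<^sup>2\<close> thus appears with coefficient one and can be absorbed by the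
  \<open>2 * n * h\<^sup>2\<close> of the likelihood inequality. The bound holds for each
  \<open>x\<close>, and the energy does not involve \<open>g\<close>.\<close>

lemma centered_sum_level_energy:
  fixes n :: nat and h C :: real
  assumes deriv: "\<And>t. (g has_real_derivative g' t) (at t)" and cont: "continuous_on UNIV g'"
    and g': "\<And>t. \<bar>g' t\<bar> \<le> h * C * exp (L * \<bar>t\<bar>)" and L: "0 \<le> L"
    and B: "(\<integral>\<^sup>+x. ennreal (exp ((2 * L + 4) * \<bar>x\<bar>)) \<partial>M) \<le> ennreal B"
    and I: "finite I" and n: "0 < n"
  shows "ennreal (2 * \<bar>\<Sum>i\<in>I. g (x i) - expectation g\<bar>)
    \<le> ennreal (real n * h\<^sup>2) + ennreal (C\<^sup>2 / real n) * level_energy L I x"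
proof -
  let ?Z = "level_sum I x"
  have [measurable]: "g' \<in> borel_measurable borel"
    using cont by (rule borel_measurable_continuous_onI)
  have [measurable]: "?Z \<in> borel_measurable borel"
    unfolding level_sum_def by measurable
  have S: "has_bochner_integral lborel (\<lambda>t. g' t * ?Z t) (\<Sum>i\<in>I. g (x i) - expectation g)"
    unfolding level_sum_def sum_distrib_left
    by (intro has_bochner_integral_sum centered_deriv_level[OF deriv cont g' L B])
  then have "ennreal \<bar>\<Sum>i\<in>I. g (x i) - expectation g\<bar> \<le> (\<integral>\<^sup>+t. ennreal \<bar>g' t * ?Z t\<bar> \<partial>lborel)"
    using integral_norm_bound_ennreal[of lborel "\<lambda>t. g' t * ?Z t"]
    by (simp add: has_bochner_integral_iff)
  then have "ennreal (2 * \<bar>\<Sum>i\<in>I. g (x i) - expectation g\<bar>) \<le> ennreal 2 * (\<integral>\<^sup>+t. ennreal \<bar>g' t * ?Z t\<bar> \<partial>lborel)"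
    by (subst ennreal_mult) (auto intro!: mult_left_mono)
  also have "\<dots> = (\<integral>\<^sup>+t. ennreal (2 * \<bar>g' t * ?Z t\<bar>) \<partial>lborel)"
    by (subst nn_integral_cmult[symmetric]) (auto simp: ennreal_mult)
  also have "\<dots> \<le> (\<integral>\<^sup>+t. ennreal (real n * h\<^sup>2) * ennreal (exp (- 2 * \<bar>t\<bar>)) +
      ennreal (C\<^sup>2 / real n) * ennreal (exp ((2 * L + 2) * \<bar>t\<bar>) * (?Z t)\<^sup>2) \<partial>lborel)"
  proof (rule nn_integral_mono)
    fix t :: real
    define p where "p = exp (- \<bar>t\<bar>)"
    define q where "q = exp ((L + 1) * \<bar>t\<bar>)"
    have pq: "exp (L * \<bar>t\<bar>) = p * q" "exp (- 2 * \<bar>t\<bar>) = p\<^sup>2" "exp ((2 * L + 2) * \<bar>t\<bar>) = q\<^sup>2"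
      by (simp_all add: p_def q_def mult_exp_exp algebra_simps flip: exp_double)
    have "2 * \<bar>g' t * ?Z t\<bar> \<le> 2 * (h * C * exp (L * \<bar>t\<bar>) * \<bar>?Z t\<bar>)"
      unfolding abs_mult using g'[of t] by (intro mult_left_mono mult_right_mono) auto
    also have "\<dots> \<le> real n * h\<^sup>2 * p\<^sup>2 + C\<^sup>2 / real n * (q\<^sup>2 * (?Z t)\<^sup>2)"
    proof -
      have "0 \<le> (real n * h * p - C * q * \<bar>?Z t\<bar>)\<^sup>2 / real n" by simp
      also have "\<dots> = real n * h\<^sup>2 * p\<^sup>2 + C\<^sup>2 / real n * (q\<^sup>2 * (?Z t)\<^sup>2) - 2 * (h * C * (p * q) * \<bar>?Z t\<bar>)"
        using n by (simp add: power2_diff power_mult_distrib field_simps) (simp add: power2_eq_square)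
      finally show ?thesis unfolding pq by linarith
    qed
    finally show "ennreal (2 * \<bar>g' t * ?Z t\<bar>) \<le> ennreal (real n * h\<^sup>2) * ennreal (exp (- 2 * \<bar>t\<bar>)) +
      ennreal (C\<^sup>2 / real n) * ennreal (exp ((2 * L + 2) * \<bar>t\<bar>) * (?Z t)\<^sup>2)"
      unfolding pq by (simp add: ennreal_leI flip: ennreal_mult ennreal_plus)
  qed
  also have "\<dots> = ennreal (real n * h\<^sup>2) * (\<integral>\<^sup>+t. ennreal (exp (- 2 * \<bar>t\<bar>)) \<partial>lborel) +
      ennreal (C\<^sup>2 / real n) * level_energy L I x"
    unfolding level_energy_def by (simp add: nn_integral_add nn_integral_cmult)
  also have "\<dots> \<le> ennreal (real n * h\<^sup>2) * 1 + ennreal (C\<^sup>2 / real n) * level_energy L I x"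
    by (intro add_right_mono mult_left_mono nn_integral_exp_abs_le) auto
  finally show ?thesis by simp
qed

end

section \<open>Risk of approximate maximum likelihood estimators\<close>

lemma real_distribution_prob_density:
  assumes "prob_density f"
  shows "real_distribution (density lborel (\<lambda>t. ennreal (f t)))"
proof -
  have [measurable]: "f \<in> borel_measurable borel" using assms by (simp add: prob_density_def)
  have "prob_space (density lborel (\<lambda>t. ennreal (f t)))"
    using assms by (intro prob_spaceI) (simp add: emeasure_density prob_density_def)
  then show ?thesis
    by (simp add: real_distribution_def real_distribution_axioms_def)
qed

lemma (in real_distribution) level_energy_measurable:
  assumes "finite I"
  shows "level_energy L I \<in> borel_measurable (Pi\<^sub>M I (\<lambda>_. M))"
proof -
  note level_sum_measurable[OF assms, measurable]
  show ?thesis unfolding level_energy_def by measurable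
qed

text \<open>The likelihood inequality bounds \<open>2 * n * h\<^sup>2\<close> by
  \<open>\<alpha>\<close> plus twice the centred sum; absorbing one \<open>n * h\<^sup>2\<close>
  leaves \<open>\<alpha>\<close> plus \<open>C\<^sup>2 / n\<close> times the energy, whose mean is
  at most \<open>n * B\<close>. All this is done sample by sample, with \<open>est x\<close> in
  place of \<open>g\<close>.\<close>

lemma approximate_mle_risk:
  fixes b \<alpha> :: real
  assumes b: "0 \<le> b" and \<alpha>: "0 \<le> \<alpha>"
  obtains C where "0 \<le> C"
    "\<And>n est f. 0 < n \<Longrightarrow> f \<in> normal_mixtures b \<Longrightarrow>
      (\<And>x. x \<in> space (sample_space n) \<Longrightarrow> est x \<in> normal_mixtures b) \<Longrightarrow>
      (\<And>x. x \<in> space (sample_space n) \<Longrightarrow>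
        (\<Sum>i = 1..n. ln (f (x i))) \<le> (\<Sum>i = 1..n. ln (est x (x i))) + \<alpha>) \<Longrightarrow>
      risk n est f \<le> ennreal (C / real n)"
proof -
  obtain C L where C: "0 \<le> C" and L: "0 \<le> L" and deriv: "\<And>f g. f \<in> normal_mixtures b \<Longrightarrow> g \<in> normal_mixtures b \<Longrightarrow>
      \<exists>s'. (\<forall>t. ((\<lambda>t. sqrt (f t / g t)) has_real_derivative s' t) (at t)) \<and>
        continuous_on UNIV s' \<and> (\<forall>t. \<bar>s' t\<bar> \<le> hellinger f g * C * exp (L * \<bar>t\<bar>))"
    using sqrt_likelihood_ratio_deriv[OF b] by blast
  define c where "c = 2 * L + 4"
  define B where "B = 2 * exp (c * b + c\<^sup>2 / 2)"
  show thesis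
  proof (rule that[of "\<alpha> + C\<^sup>2 * B"])
    show "0 \<le> \<alpha> + C\<^sup>2 * B" using \<alpha> by (simp add: B_def)
    fix n :: nat and est f
    assume n: "0 < n" and f: "f \<in> normal_mixtures b"
      and est: "\<And>x. x \<in> space (sample_space n) \<Longrightarrow> est x \<in> normal_mixtures b"
      and mle: "\<And>x. x \<in> space (sample_space n) \<Longrightarrow>
        (\<Sum>i = 1..n. ln (f (x i))) \<le> (\<Sum>i = 1..n. ln (est x (x i))) + \<alpha>"
    define M where "M = density lborel (\<lambda>t. ennreal (f t))"
    note f_pd = normal_mixture_prob_density[OF f]
    have [measurable]: "f \<in> borel_measurable borel" using f_pd by (simp add: prob_density_def)
    interpret real_distribution M
      unfolding M_def by (rule real_distribution_prob_density[OF f_pd])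
    interpret P: product_prob_space "\<lambda>_. M" "{1..n}"
      by unfold_locales
    have B: "(\<integral>\<^sup>+x. ennreal (exp ((2 * L + 4) * \<bar>x\<bar>)) \<partial>M) \<le> ennreal B"
    proof -
      have "(\<integral>\<^sup>+x. ennreal (exp (c * \<bar>x\<bar>)) \<partial>M) = (\<integral>\<^sup>+x. ennreal (exp (c * \<bar>x\<bar>) * f x) \<partial>lborel)"
        unfolding M_def using f_pd
        by (subst nn_integral_density) (auto simp: prob_density_def ennreal_mult mult.commute)
      also have "\<dots> \<le> ennreal B"
        unfolding B_def using L by (intro normal_mixture_exp_moment f) (simp add: c_def)
      finally show ?thesis unfolding c_def .
    qed
    let ?I = "{1..n}" and ?V = "level_energy L {1..n}"
    have law: "sample_law n f = Pi\<^sub>M ?I (\<lambda>_. M)" by (simp add: sample_law_def M_def)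
    have sp: "space (Pi\<^sub>M ?I (\<lambda>_. M)) = space (sample_space n)"
      by (simp add: sample_space_def space_PiM)
    have key: "ennreal ((hellinger (est x) f)\<^sup>2)
        \<le> ennreal (1 / real n) * (ennreal \<alpha> + ennreal (C\<^sup>2 / real n) * ?V x)"
      if x: "x \<in> space (sample_space n)" for x
    proof -
      define g where "g = est x"
      define h where "h = hellinger g f"
      define s where "s t = sqrt (g t / f t)" for t
      have g: "g \<in> normal_mixtures b" unfolding g_def by (rule est[OF x])
      note g_pd = normal_mixture_prob_density[OF g]
      have pos: "0 < f t" "0 < g t" for t using normal_mixture_pos f g by auto
      have [measurable]: "g \<in> borel_measurable borel" using g_pd by (simp add: prob_density_def)
      obtain s' where s': "\<And>t. (s has_real_derivative s' t) (at t)" "continuous_on UNIV s'"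
          "\<And>t. \<bar>s' t\<bar> \<le> h * C * exp (L * \<bar>t\<bar>)"
        using deriv[OF g f] unfolding s_def h_def by blast
      have "expectation s = (\<integral>t. f t * s t \<partial>lborel)"
        unfolding M_def s_def using pos by (subst integral_density) (auto intro: less_imp_le)
      also have "\<dots> = (\<integral>t. sqrt (g t) * sqrt (f t) \<partial>lborel)"
      proof (intro Bochner_Integration.integral_cong refl)
        fix t
        have "f t = sqrt (f t) * sqrt (f t)" using pos[of t] by simp
        then show "f t * s t = sqrt (g t) * sqrt (f t)"
          using pos[of t] by (simp add: s_def real_sqrt_divide field_simps)
      qed
      also have "\<dots> = 1 - h\<^sup>2"
        using hellinger_affinity[OF g_pd f_pd] by (simp add: has_bochner_integral_iff h_def)
      finally have mean: "expectation s = 1 - h\<^sup>2" .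
      have "ln (g t) - ln (f t) \<le> 2 * (s t - 1)" for t
      proof -
        have "ln (g t) - ln (f t) = 2 * ln (s t)"
          using pos[of t] by (simp add: s_def ln_sqrt ln_div)
        also have "\<dots> \<le> 2 * (s t - 1)"
          using pos[of t] by (intro mult_left_mono ln_le_minus_one) (auto simp: s_def)
        finally show ?thesis .
      qed
      then have "(\<Sum>i\<in>?I. ln (g (x i))) - (\<Sum>i\<in>?I. ln (f (x i))) \<le> 2 * (\<Sum>i\<in>?I. s (x i) - 1)"
        unfolding sum_subtractf[symmetric] sum_distrib_left by (intro sum_mono)
      moreover have "(\<Sum>i\<in>?I. s (x i) - expectation s) = (\<Sum>i\<in>?I. s (x i) - 1) + real n * h\<^sup>2"
        unfolding mean by (simp add: sum_subtractf sum.distrib algebra_simps)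
      ultimately have "real n * h\<^sup>2 + real n * h\<^sup>2 \<le> \<alpha> + 2 * \<bar>\<Sum>i\<in>?I. s (x i) - expectation s\<bar>"
        using mle[OF x] unfolding g_def[symmetric] by linarith
      then have "ennreal (real n * h\<^sup>2) + ennreal (real n * h\<^sup>2)
          \<le> ennreal \<alpha> + ennreal (2 * \<bar>\<Sum>i\<in>?I. s (x i) - expectation s\<bar>)"
        using \<alpha> by (simp flip: ennreal_plus)
      also have "\<dots> \<le> ennreal \<alpha> + (ennreal (real n * h\<^sup>2) + ennreal (C\<^sup>2 / real n) * ?V x)"
        using n by (intro add_left_mono centered_sum_level_energy[OF s' L B]) auto
      also have "\<dots> = ennreal (real n * h\<^sup>2) + (ennreal \<alpha> + ennreal (C\<^sup>2 / real n) * ?V x)"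
        by (simp add: add_ac)
      \<comment> \<open>The cancelled term is finite, so this is sound even where the energy is
        infinite.\<close>
      finally have "ennreal (real n * h\<^sup>2) \<le> ennreal \<alpha> + ennreal (C\<^sup>2 / real n) * ?V x"
        by (simp add: ennreal_add_left_cancel_le)
      then have "ennreal (1 / real n) * ennreal (real n * h\<^sup>2)
          \<le> ennreal (1 / real n) * (ennreal \<alpha> + ennreal (C\<^sup>2 / real n) * ?V x)"
        by (rule mult_left_mono) simp
      moreover have "ennreal (1 / real n) * ennreal (real n * h\<^sup>2) = ennreal (h\<^sup>2)"
        using n by (subst ennreal_mult[symmetric]) auto
      ultimately show ?thesis by (simp add: h_def g_def)
    qed
    note level_energy_measurable[OF finite_atLeastAtMost, measurable]
    have "risk n est f \<le> (\<integral>\<^sup>+x. ennreal (1 / real n) * (ennreal \<alpha> + ennreal (C\<^sup>2 / real n) * ?V x)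
        \<partial>Pi\<^sub>M ?I (\<lambda>_. M))"
      unfolding risk_def law by (intro nn_integral_mono key) (simp only: sp)
    also have "\<dots> = ennreal (1 / real n) *
        (ennreal \<alpha> + ennreal (C\<^sup>2 / real n) * (\<integral>\<^sup>+x. ?V x \<partial>Pi\<^sub>M ?I (\<lambda>_. M)))"
      by (simp add: nn_integral_cmult nn_integral_add P.P.emeasure_space_1[unfolded One_nat_def])
    also have "\<dots> \<le> ennreal (1 / real n) *
        (ennreal \<alpha> + ennreal (C\<^sup>2 / real n) * (ennreal (real (card ?I)) * ennreal B))"
      by (intro mult_left_mono add_left_mono level_energy_expectation L B) auto
    also have "\<dots> = ennreal ((\<alpha> + C\<^sup>2 * B) / real n)"
      using n \<alpha> by (simp add: B_def flip: ennreal_mult ennreal_plus)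
    finally show "risk n est f \<le> ennreal ((\<alpha> + C\<^sup>2 * B) / real n)" .
  qed
qed

section \<open>The AIC estimator as an approximate maximum likelihood estimator\<close>

lemma aic_index_eq:
  "aic_index a n fhat x = (if aic_criterion a n fhat x 1 \<le> aic_criterion a n fhat x 2 then 1 else 2)"
proof -
  let ?c = "aic_criterion a n fhat x"
  let ?S = "{k. is_arg_min ?c (\<lambda>j. j \<in> {1, 2}) k}"
  have "?S = (if ?c 1 < ?c 2 then {1} else if ?c 1 = ?c 2 then {1, 2} else {2})"
    by (auto simp: is_arg_min_def)
  then show ?thesis unfolding aic_index_def by auto
qed

text \<open>Give two equal means the admissible weight \<open>1 / 2\<close>. By this nesting the fit
  over \<open>model2\<close> maximises the likelihood over \<open>full_model\<close>, and the AIC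
  choice need only be compared with \<open>k = 2\<close>.\<close>

lemma model1_subset_model2:
  assumes "p \<le> 1 / 2"
  shows "model1 b \<subseteq> model2 b p"
proof
  fix f assume "f \<in> model1 b"
  then obtain \<mu> where "f = normal_density \<mu> 1" "\<mu> \<in> {-b..b}"
    unfolding model1_def by blast
  then have "f = (\<lambda>t. 1 / 2 * normal_density \<mu> 1 t + (1 - 1 / 2) * normal_density \<mu> 1 t) \<and>
      (1 / 2 :: real) \<in> {p..1 - p} \<and> \<mu> \<in> {-b..b} \<and> \<mu> \<in> {-b..b} \<and> \<mu> \<le> \<mu>"
    using assms by (auto simp: fun_eq_iff)
  then show "f \<in> model2 b p" unfolding model2_def by blast
qed

text \<open>The chosen criterion is at most that of \<open>k = 2\<close>, whose penalty is
  \<open>3 * a / n\<close>; dropping the penalty of the chosen model and multiplying by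
  \<open>n\<close> leaves a loss of \<open>3 * a\<close>. No probability of selecting either model
  has to be estimated.\<close>

lemma aic_estimator_loglik:
  assumes mle: "\<And>k. k \<in> {1, 2} \<Longrightarrow> is_mle b p n k (fhat k)" and x: "x \<in> space (sample_space n)"
    and f: "f \<in> full_model b p" and p: "p \<le> 1 / 2" and a: "0 \<le> a" and n: "0 < n"
  shows "aic_estimator a n fhat x \<in> full_model b p"
    and "(\<Sum>i = 1..n. ln (f (x i))) \<le> (\<Sum>i = 1..n. ln (aic_estimator a n fhat x (x i))) + 3 * a"
proof -
  let ?k = "aic_index a n fhat x"
  have arg_min: "is_arg_min (neg_loglik n x) (\<lambda>f. f \<in> model b p k) (fhat k x)" if "k \<in> {1, 2}" for k
    using mle[OF that] x unfolding is_mle_def by blast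
  have k: "?k \<in> {1, 2}" by (simp add: aic_index_eq)
  have "fhat ?k x \<in> model b p ?k" using arg_min[OF k] by (simp add: is_arg_min_def)
  then show "aic_estimator a n fhat x \<in> full_model b p"
    unfolding aic_estimator_def model_def full_model_def by (auto split: if_splits)
  have "f \<in> model b p 2"
    using f model1_subset_model2[OF p] by (auto simp: model_def full_model_def)
  then have "neg_loglik n x (fhat 2 x) \<le> neg_loglik n x f"
    using arg_min[of 2] by (auto simp: is_arg_min_def not_less)
  moreover have d2: "model_dim 2 = 3" by (simp add: model_dim_def)
  moreover have "aic_criterion a n fhat x ?k \<le> aic_criterion a n fhat x 2"
    by (auto simp: aic_index_eq)
  moreover have "0 \<le> a * real (model_dim ?k) / real n" using a by simp
  ultimately have "neg_loglik n x (fhat ?k x) \<le> neg_loglik n x f + 3 * a / real n"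
    unfolding aic_criterion_def d2 by (simp add: mult.commute)
  then have "real n * neg_loglik n x (fhat ?k x) \<le> real n * (neg_loglik n x f + 3 * a / real n)"
    by (intro mult_left_mono) auto
  also have "\<dots> = real n * neg_loglik n x f + 3 * a"
    using n by (simp add: distrib_left)
  finally have "real n * neg_loglik n x (fhat ?k x) \<le> real n * neg_loglik n x f + 3 * a" .
  moreover have "real n * neg_loglik n x g = - (\<Sum>i = 1..n. ln (g (x i)))" for g
    using n by (simp add: neg_loglik_def)
  ultimately show "(\<Sum>i = 1..n. ln (f (x i))) \<le> (\<Sum>i = 1..n. ln (aic_estimator a n fhat x (x i))) + 3 * a"
    unfolding aic_estimator_def by simp
qed

text \<open>This lets the AIC estimator compete in the infimum defining \<open>minimax_risk\<close>,
  which gives the middle inequality.\<close>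

lemma aic_estimator_is_estimator:
  assumes mle: "\<And>k. k \<in> {1, 2} \<Longrightarrow> is_mle b p n k (fhat k)"
    and p: "0 \<le> p" "p \<le> 1 / 2" and b: "0 \<le> b" and a: "0 \<le> a" and n: "0 < n"
  shows "estimator n (aic_estimator a n fhat)"
  unfolding estimator_def
proof
  have [measurable]: "(\<lambda>z. fhat 1 (fst z) (snd z)) \<in> borel_measurable (sample_space n \<Otimes>\<^sub>M borel)"
      "(\<lambda>z. fhat 2 (fst z) (snd z)) \<in> borel_measurable (sample_space n \<Otimes>\<^sub>M borel)"
    using mle[of 1] mle[of 2] by (auto simp: is_mle_def split_beta')
  have coord [measurable]: "(\<lambda>x. x i) \<in> borel_measurable (sample_space n)" if "i \<in> {1..n}" for i
    unfolding sample_space_def using that by measurable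
  have crit: "(\<lambda>x. aic_criterion a n fhat x k) \<in> borel_measurable (sample_space n)" if "k \<in> {1, 2}" for k
  proof -
    \<comment> \<open>The sample enters twice, through the fit and through its argument, hence the
      composition with joint measurability.\<close>
    have "(\<lambda>x. fhat k x (x i)) \<in> borel_measurable (sample_space n)" if i: "i \<in> {1..n}" for i
    proof -
      have "(\<lambda>(x, t). fhat k x t) \<in> borel_measurable (sample_space n \<Otimes>\<^sub>M borel)"
        using mle[OF \<open>k \<in> {1, 2}\<close>] by (simp add: is_mle_def)
      from measurable_compose[OF measurable_Pair[OF measurable_ident_sets[OF refl] coord[OF i]] this]
      show ?thesis by simp
    qed
    note this[measurable]
    show ?thesis unfolding aic_criterion_def neg_loglik_def
      by (intro borel_measurable_add borel_measurable_times borel_measurable_const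
          borel_measurable_sum borel_measurable_ln) auto
  qed
  have [measurable]: "(\<lambda>x. aic_criterion a n fhat x 1) \<in> borel_measurable (sample_space n)"
      "(\<lambda>x. aic_criterion a n fhat x 2) \<in> borel_measurable (sample_space n)"
    by (rule crit, simp)+
  have "(\<lambda>(x, t). aic_estimator a n fhat x t) = (\<lambda>z. if aic_criterion a n fhat (fst z) 1
      \<le> aic_criterion a n fhat (fst z) 2 then fhat 1 (fst z) (snd z) else fhat 2 (fst z) (snd z))"
    by (auto simp: aic_estimator_def aic_index_eq fun_eq_iff)
  also have "\<dots> \<in> borel_measurable (sample_space n \<Otimes>\<^sub>M borel)"
    by measurable
  finally show "(\<lambda>(x, t). aic_estimator a n fhat x t) \<in> borel_measurable (sample_space n \<Otimes>\<^sub>M borel)" .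
  \<comment> \<open>\<open>aic_estimator_loglik\<close> is stated for a competitor in
    \<open>full_model\<close>; this supplies one.\<close>
  have "normal_density 0 1 \<in> full_model b p"
    using b unfolding full_model_def model1_def by auto
  then show "\<forall>x\<in>space (sample_space n). prob_density (aic_estimator a n fhat x)"
    using aic_estimator_loglik(1)[OF mle _ _ p(2) a n] full_model_subset[of p b] p
      normal_mixture_prob_density by fastforce
qed

section \<open>The two-point lower bound\<close>

text \<open>Both measures agree on rectangles by Tonelli. The sample law for one mean thereby gets a
  product likelihood ratio relative to that for the other.\<close>

lemma density_PiM:
  assumes M: "prob_space M" and I: "finite I" and [measurable]: "l \<in> borel_measurable M"
    and one: "prob_space (density M l)"
  shows "Pi\<^sub>M I (\<lambda>_. density M l) = density (Pi\<^sub>M I (\<lambda>_. M)) (\<lambda>x. \<Prod>i\<in>I. l (x i))"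
proof -
  interpret M: prob_space M by (rule M)
  interpret N: prob_space "density M l" by (rule one)
  interpret P: product_prob_space "\<lambda>_. M" I by unfold_locales
  interpret Q: product_prob_space "\<lambda>_. density M l" I by unfold_locales
  show ?thesis
  proof (rule Q.PiM_eqI[OF I, symmetric])
    show "sets (density (Pi\<^sub>M I (\<lambda>_. M)) (\<lambda>x. \<Prod>i\<in>I. l (x i))) = sets (Pi\<^sub>M I (\<lambda>_. density M l))"
      by (simp cong: sets_PiM_cong)
    fix A assume A: "\<And>i. i \<in> I \<Longrightarrow> A i \<in> sets (density M l)"
    then have A': "Pi\<^sub>E I A \<in> sets (Pi\<^sub>M I (\<lambda>_. M))" using I by (intro sets_PiM_I_finite) auto
    have "emeasure (density (Pi\<^sub>M I (\<lambda>_. M)) (\<lambda>x. \<Prod>i\<in>I. l (x i))) (Pi\<^sub>E I A) =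
        (\<integral>\<^sup>+x. (\<Prod>i\<in>I. l (x i)) * indicator (Pi\<^sub>E I A) x \<partial>Pi\<^sub>M I (\<lambda>_. M))"
      by (intro emeasure_density A') measurable
    also have "\<dots> = (\<integral>\<^sup>+x. (\<Prod>i\<in>I. l (x i) * indicator (A i) (x i)) \<partial>Pi\<^sub>M I (\<lambda>_. M))"
    proof (rule nn_integral_cong)
      fix x assume x: "x \<in> space (Pi\<^sub>M I (\<lambda>_. M))"
      have "indicator (Pi\<^sub>E I A) x = (\<Prod>i\<in>I. indicator (A i) (x i) :: ennreal)"
        using x I by (auto simp: indicator_def space_PiM PiE_iff prod_eq_1_iff prod_zero_iff extensional_def)
      then show "(\<Prod>i\<in>I. l (x i)) * indicator (Pi\<^sub>E I A) x = (\<Prod>i\<in>I. l (x i) * indicator (A i) (x i))"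
        by (simp add: prod.distrib)
    qed
    also have "\<dots> = (\<Prod>i\<in>I. \<integral>\<^sup>+y. l y * indicator (A i) y \<partial>M)"
      using A by (intro P.product_nn_integral_prod I) auto
    also have "\<dots> = (\<Prod>i\<in>I. emeasure (density M l) (A i))"
      using A by (intro prod.cong refl emeasure_density[symmetric]) auto
    finally show "emeasure (density (Pi\<^sub>M I (\<lambda>_. M)) (\<lambda>x. \<Prod>i\<in>I. l (x i))) (Pi\<^sub>E I A) =
        (\<Prod>i\<in>I. emeasure (density M l) (A i))" .
  qed
qed

lemma normal_density_affinity:
  "sqrt (normal_density 0 1 t) * sqrt (normal_density \<delta> 1 t) = exp (- \<delta>\<^sup>2 / 8) * normal_density (\<delta> / 2) 1 t"
proof -
  have "normal_density 0 1 t * normal_density \<delta> 1 t = (exp (- \<delta>\<^sup>2 / 8) * normal_density (\<delta> / 2) 1 t)\<^sup>2"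
    by (simp add: normal_density_def power_mult_distrib power_divide mult_exp_exp power2_eq_square field_simps)
  then show ?thesis
    by (simp add: real_sqrt_mult[symmetric])
qed

lemma hellinger_normal_density:
  "(hellinger (normal_density 0 1) (normal_density \<delta> 1))\<^sup>2 = 1 - exp (- \<delta>\<^sup>2 / 8)"
proof -
  have pd: "prob_density (normal_density \<mu> 1)" for \<mu>
    by (simp add: prob_density_def nn_integral_normal_density)
  show ?thesis
    using hellinger_affinity[OF pd[of 0] pd[of \<delta>]]
    unfolding normal_density_affinity by (simp add: has_bochner_integral_iff)
qed

lemma hellinger_sq_triangle:
  assumes "prob_density e" "prob_density f" "prob_density g"
  shows "(hellinger f g)\<^sup>2 \<le> 2 * (hellinger e f)\<^sup>2 + 2 * (hellinger e g)\<^sup>2"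
proof -
  have "(\<integral>t. (sqrt (f t) - sqrt (g t))\<^sup>2 \<partial>lborel) \<le>
      (\<integral>t. 2 * (sqrt (e t) - sqrt (f t))\<^sup>2 + 2 * (sqrt (e t) - sqrt (g t))\<^sup>2 \<partial>lborel)"
  proof (rule integral_mono)
    fix t
    have "(s - u)\<^sup>2 \<le> 2 * (r - s)\<^sup>2 + 2 * (r - u)\<^sup>2" for r s u :: real
      using zero_le_power2[of "(r - s) + (r - u)"] by (simp add: power2_eq_square algebra_simps)
    then show "(sqrt (f t) - sqrt (g t))\<^sup>2 \<le> 2 * (sqrt (e t) - sqrt (f t))\<^sup>2 + 2 * (sqrt (e t) - sqrt (g t))\<^sup>2" .
  qed (use hellinger_integrable assms in auto)
  also have "\<dots> = 2 * (\<integral>t. (sqrt (e t) - sqrt (f t))\<^sup>2 \<partial>lborel) + 2 * (\<integral>t. (sqrt (e t) - sqrt (g t))\<^sup>2 \<partial>lborel)"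
    using hellinger_integrable assms by simp
  finally show ?thesis unfolding hellinger_sq by simp
qed

lemma hellinger_estimator_measurable:
  assumes est: "estimator n est" and [measurable]: "f \<in> borel_measurable borel"
  shows "(\<lambda>x. (hellinger (est x) f)\<^sup>2) \<in> borel_measurable (sample_space n)"
proof -
  have "sets (sample_space n \<Otimes>\<^sub>M lborel) = sets (sample_space n \<Otimes>\<^sub>M borel)"
    by (intro sets_pair_measure_cong) auto
  then have [measurable]: "(\<lambda>z. est (fst z) (snd z)) \<in> borel_measurable (sample_space n \<Otimes>\<^sub>M lborel)"
    using est by (simp add: estimator_def split_beta' cong: measurable_cong_sets)
  have "(\<lambda>x. \<integral>t. (sqrt (est x t) - sqrt (f t))\<^sup>2 \<partial>lborel) \<in> borel_measurable (sample_space n)"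
    by (rule lborel.borel_measurable_lebesgue_integral) (simp add: split_beta')
  then show ?thesis unfolding hellinger_sq by measurable
qed

lemma sqrt_prod: "sqrt (\<Prod>i\<in>I. f i) = (\<Prod>i\<in>I. sqrt (f i))"
  by (induction I rule: infinite_finite_induct) (simp_all add: real_sqrt_mult)

text \<open>Le Cam's two-point method. With \<open>\<delta>\<^sup>2 = 1 / n\<close> the affinity of
  the two sample laws is \<open>exp (- 1 / 8)\<close> for every \<open>n\<close>, which keeps the
  mass common to both laws at least \<open>3 / 8\<close>. No density is close to both normal
  densities, so that mass costs at least \<open>h / 2 \<ge> 1 / (32 * n)\<close> in the two risks
  together.\<close>

lemma two_point_risk_bound:
  fixes \<delta> :: real
  assumes est: "estimator n est" and n: "0 < n" and \<delta>: "\<delta>\<^sup>2 = 1 / real n"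
  shows "ennreal (3 / (256 * real n)) \<le> risk n est (normal_density 0 1) + risk n est (normal_density \<delta> 1)"
proof -
  define J where "J = {1..n}"
  have J: "finite J" "card J = n" by (simp_all add: J_def)
  define q\<^sub>0 where "q\<^sub>0 = normal_density 0 1"
  define q\<^sub>1 where "q\<^sub>1 = normal_density \<delta> 1"
  define M where "M = density lborel (\<lambda>t. ennreal (q\<^sub>0 t))"
  define l where "l t = q\<^sub>1 t / q\<^sub>0 t" for t
  define \<Lambda> where "\<Lambda> x = (\<Prod>i\<in>J. l (x i))" for x :: "nat \<Rightarrow> real"
  let ?P = "Pi\<^sub>M J (\<lambda>_. M)"
  have pos: "0 < q\<^sub>0 t" "0 < q\<^sub>1 t" "0 < l t" for t
    by (simp_all add: q\<^sub>0_def q\<^sub>1_def l_def normal_density_pos)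
  have pd: "prob_density q\<^sub>0" "prob_density q\<^sub>1"
    by (simp_all add: prob_density_def q\<^sub>0_def q\<^sub>1_def nn_integral_normal_density)
  have [measurable]: "q\<^sub>0 \<in> borel_measurable borel" "q\<^sub>1 \<in> borel_measurable borel"
    using pd by (auto simp: prob_density_def)
  have [measurable]: "l \<in> borel_measurable borel" unfolding l_def by measurable
  interpret real_distribution M
    unfolding M_def by (rule real_distribution_prob_density[OF pd(1)])
  interpret P: product_prob_space "\<lambda>_. M" "J" by unfold_locales
  have dens: "density lborel (\<lambda>t. ennreal (q\<^sub>1 t)) = density M (\<lambda>t. ennreal (l t))"
    unfolding M_def using pos
    by (subst density_density_eq) (auto simp: l_def ennreal_mult[symmetric] less_imp_le less_imp_neq[symmetric] intro!: density_cong)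
  have "prob_space (density M (\<lambda>t. ennreal (l t)))"
    unfolding dens[symmetric] using real_distribution_prob_density[OF pd(2)] by (simp add: real_distribution_def)
  from density_PiM[OF prob_space_axioms J(1) _ this]
  have law1: "sample_law n q\<^sub>1 = density ?P (\<lambda>x. ennreal (\<Lambda> x))"
    unfolding sample_law_def J_def[symmetric] dens \<Lambda>_def using pos by (simp add: prod_ennreal less_imp_le)
  have law0: "sample_law n q\<^sub>0 = ?P" by (simp add: sample_law_def M_def J_def)
  have sets_P: "sets ?P = sets (sample_space n)"
    unfolding sample_space_def J_def by (intro sets_PiM_cong) auto
  have \<Lambda>0: "0 \<le> \<Lambda> x" for x unfolding \<Lambda>_def using pos by (intro prod_nonneg) (auto intro: less_imp_le)
  have [measurable]: "\<Lambda> \<in> borel_measurable ?P" unfolding \<Lambda>_def by measurable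
  have [measurable]: "(\<lambda>x. (hellinger (est x) q\<^sub>0)\<^sup>2) \<in> borel_measurable ?P"
      "(\<lambda>x. (hellinger (est x) q\<^sub>1)\<^sup>2) \<in> borel_measurable ?P"
    using hellinger_estimator_measurable[OF est] sets_P by (auto cong: measurable_cong_sets)
  define h where "h = (hellinger q\<^sub>0 q\<^sub>1)\<^sup>2"
  have h: "1 / (16 * real n) \<le> h"
  proof -
    define y where "y = 1 / (8 * real n)"
    have y: "0 < y" "y \<le> 1" using n by (auto simp: y_def)
    have "exp (- y) \<le> 1 / (1 + y)"
      using exp_ge_add_one_self[of y] y by (simp add: exp_minus field_simps)
    also have "\<dots> \<le> 1 - y / 2" using y mult_left_mono[of y 1 y] by (simp add: field_simps)
    finally have "y / 2 \<le> 1 - exp (- y)" by simp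
    moreover have "h = 1 - exp (- y)"
      unfolding h_def q\<^sub>0_def q\<^sub>1_def hellinger_normal_density \<delta> by (simp add: y_def mult.commute)
    ultimately show ?thesis by (simp add: y_def)
  qed
  have "ennreal (exp (- 1 / 8)) = (\<integral>\<^sup>+x. (\<Prod>i\<in>J. ennreal (sqrt (l (x i)))) \<partial>?P)"
  proof -
    have "(\<integral>\<^sup>+t. ennreal (sqrt (l t)) \<partial>M) = (\<integral>\<^sup>+t. ennreal (exp (- \<delta>\<^sup>2 / 8)) * ennreal (normal_density (\<delta> / 2) 1 t) \<partial>lborel)"
    proof -
      have "q\<^sub>0 t * sqrt (l t) = exp (- \<delta>\<^sup>2 / 8) * normal_density (\<delta> / 2) 1 t" for t
      proof -
        have "q\<^sub>0 t = sqrt (q\<^sub>0 t) * sqrt (q\<^sub>0 t)" using pos[of t] by simp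
        then have "q\<^sub>0 t * sqrt (l t) = sqrt (q\<^sub>0 t) * sqrt (q\<^sub>1 t)"
          using pos[of t] by (simp add: l_def real_sqrt_divide field_simps)
        then show ?thesis unfolding q\<^sub>0_def q\<^sub>1_def normal_density_affinity .
      qed
      then show ?thesis unfolding M_def using pos
        by (subst nn_integral_density) (auto simp: less_imp_le simp flip: ennreal_mult)
    qed
    also have "\<dots> = ennreal (exp (- \<delta>\<^sup>2 / 8))"
      by (simp add: nn_integral_cmult nn_integral_normal_density)
    finally have "(\<integral>\<^sup>+x. (\<Prod>i\<in>J. ennreal (sqrt (l (x i)))) \<partial>?P) = ennreal (exp (- \<delta>\<^sup>2 / 8)) ^ n"
      using J by (subst P.product_nn_integral_prod) auto
    also have "\<dots> = ennreal (exp (- 1 / 8))"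
      using n by (simp add: \<delta> ennreal_power exp_of_nat_mult[symmetric])
    finally show ?thesis by simp
  qed
  also have "\<dots> = (\<integral>\<^sup>+x. ennreal (sqrt (\<Lambda> x)) \<partial>?P)"
    using pos by (intro nn_integral_cong) (simp add: prod_ennreal less_imp_le \<Lambda>_def sqrt_prod)
  \<comment> \<open>From \<open>sqrt \<Lambda> \<le> \<Lambda> + 1 / 4\<close> and
    \<open>sqrt \<Lambda> \<le> 1 + \<Lambda> / 4\<close>. As \<open>1\<close> and
    \<open>\<Lambda>\<close> both integrate to one, the surplus is \<open>1 / 2\<close>, and
    \<open>exp (- 1 / 8) \<ge> 7 / 8\<close> leaves \<open>3 / 8\<close>.\<close>
  also have "\<dots> \<le> (\<integral>\<^sup>+x. ennreal (min 1 (\<Lambda> x)) + ennreal (1 / 4) * (1 + ennreal (\<Lambda> x)) \<partial>?P)"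
  proof (rule nn_integral_mono)
    fix x
    define r where "r = sqrt (\<Lambda> x)"
    have r: "\<Lambda> x = r\<^sup>2" "0 \<le> r" using \<Lambda>0[of x] by (simp_all add: r_def)
    have "r \<le> r\<^sup>2 + 1 / 4" "r \<le> 1 + r\<^sup>2 / 4"
      using zero_le_power2[of "r - 1 / 2"] zero_le_power2[of "r / 2 - 1"]
      by (simp_all add: power2_diff power_divide)
    moreover have "r \<le> min 1 R + 1 / 4 * (1 + R)" if "r \<le> R + 1 / 4" "r \<le> 1 + R / 4" "0 \<le> R" for R
      using that by (simp add: min_def add_divide_distrib)
    ultimately have "r \<le> min 1 (r\<^sup>2) + 1 / 4 * (1 + r\<^sup>2)" by simp
    then have "ennreal (sqrt (\<Lambda> x)) \<le> ennreal (min 1 (\<Lambda> x) + 1 / 4 * (1 + \<Lambda> x))"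
      using r by (intro ennreal_leI) simp
    also have "\<dots> = ennreal (min 1 (\<Lambda> x)) + ennreal (1 / 4 * (1 + \<Lambda> x))"
      using \<Lambda>0[of x] by (intro ennreal_plus) auto
    also have "ennreal (1 / 4 * (1 + \<Lambda> x)) = ennreal (1 / 4) * ennreal (1 + \<Lambda> x)"
      using \<Lambda>0[of x] by (intro ennreal_mult) auto
    also have "ennreal (1 + \<Lambda> x) = 1 + ennreal (\<Lambda> x)"
      using \<Lambda>0[of x] by (simp add: ennreal_plus)
    finally show "ennreal (sqrt (\<Lambda> x)) \<le> ennreal (min 1 (\<Lambda> x)) + ennreal (1 / 4) * (1 + ennreal (\<Lambda> x))" .
  qed
  also have "\<dots> = (\<integral>\<^sup>+x. ennreal (min 1 (\<Lambda> x)) \<partial>?P) + ennreal (1 / 4) * (1 + (\<integral>\<^sup>+x. ennreal (\<Lambda> x) \<partial>?P))"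
    using \<Lambda>0 by (subst nn_integral_add) (auto simp: nn_integral_cmult nn_integral_add P.P.emeasure_space_1)
  also have "(\<integral>\<^sup>+x. ennreal (\<Lambda> x) \<partial>?P) = 1"
  proof -
    interpret D: real_distribution "density lborel (\<lambda>t. ennreal (q\<^sub>1 t))"
      by (rule real_distribution_prob_density[OF pd(2)])
    interpret R: product_prob_space "\<lambda>_. density lborel (\<lambda>t. ennreal (q\<^sub>1 t))" "J" by unfold_locales
    have "emeasure (density ?P (\<lambda>x. ennreal (\<Lambda> x))) (space ?P) = 1"
      using R.P.emeasure_space_1 unfolding law1[symmetric] sample_law_def J_def[symmetric] by (simp add: space_PiM)
    then show ?thesis by (simp add: emeasure_density)
  qed
  also have "ennreal (1 / 4) * (1 + 1) = ennreal (1 / 4) * ennreal 2" by simp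
  also have "\<dots> = ennreal (1 / 4 * 2)" by (rule ennreal_mult[symmetric]) auto
  also have "1 / 4 * 2 = (1 / 2 :: real)" by simp
  finally have "ennreal (exp (- 1 / 8)) \<le> (\<integral>\<^sup>+x. ennreal (min 1 (\<Lambda> x)) \<partial>?P) + ennreal (1 / 2)" .
  moreover have "ennreal (1 / 2) + ennreal (3 / 8) \<le> ennreal (exp (- 1 / 8))"
  proof -
    have "ennreal (1 / 2) + ennreal (3 / 8) = ennreal (1 / 2 + 3 / 8)"
      by (rule ennreal_plus[symmetric]) auto
    also have "\<dots> \<le> ennreal (exp (- 1 / 8))"
      using exp_ge_add_one_self[of "- 1 / 8"] by (intro ennreal_leI) simp
    finally show ?thesis .
  qed
  ultimately have "ennreal (1 / 2) + ennreal (3 / 8) \<le> ennreal (1 / 2) + (\<integral>\<^sup>+x. ennreal (min 1 (\<Lambda> x)) \<partial>?P)"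
    unfolding add.commute[of _ "ennreal (1 / 2)"] by (rule order_trans[rotated])
  then have testing: "ennreal (3 / 8) \<le> (\<integral>\<^sup>+x. ennreal (min 1 (\<Lambda> x)) \<partial>?P)"
    unfolding ennreal_add_left_cancel_le by (elim disjE) auto
  have "ennreal (3 / (256 * real n)) = ennreal (1 / (32 * real n) * (3 / 8))" by simp
  also have "\<dots> = ennreal (1 / (32 * real n)) * ennreal (3 / 8)" by (rule ennreal_mult) auto
  also have "\<dots> \<le> ennreal (h / 2) * (\<integral>\<^sup>+x. ennreal (min 1 (\<Lambda> x)) \<partial>?P)"
    using h by (intro mult_mono testing ennreal_leI) auto
  also have "\<dots> = (\<integral>\<^sup>+x. ennreal (h / 2) * ennreal (min 1 (\<Lambda> x)) \<partial>?P)"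
    by (rule nn_integral_cmult[symmetric]) measurable
  also have "\<dots> \<le> (\<integral>\<^sup>+x. ennreal ((hellinger (est x) q\<^sub>0)\<^sup>2) + ennreal (\<Lambda> x) * ennreal ((hellinger (est x) q\<^sub>1)\<^sup>2) \<partial>?P)"
  proof (rule nn_integral_mono)
    fix x assume "x \<in> space ?P"
    then have "prob_density (est x)"
      using est sets_eq_imp_space_eq[OF sets_P] by (simp add: estimator_def)
    then have "h / 2 \<le> (hellinger (est x) q\<^sub>0)\<^sup>2 + (hellinger (est x) q\<^sub>1)\<^sup>2"
      using hellinger_sq_triangle[of "est x" q\<^sub>0 q\<^sub>1] pd by (simp add: h_def)
    \<comment> \<open>The minimum is bounded by \<open>1\<close> in front of the first loss and by
      \<open>\<Lambda>\<close> in front of the second; weighting by \<open>\<Lambda>\<close> changes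
      the law to that of \<open>q\<^sub>1\<close>.\<close>
    then have "h / 2 * min 1 (\<Lambda> x) \<le> ((hellinger (est x) q\<^sub>0)\<^sup>2 + (hellinger (est x) q\<^sub>1)\<^sup>2) * min 1 (\<Lambda> x)"
      using \<Lambda>0[of x] by (intro mult_right_mono) auto
    also have "\<dots> \<le> (hellinger (est x) q\<^sub>0)\<^sup>2 * 1 + (hellinger (est x) q\<^sub>1)\<^sup>2 * \<Lambda> x"
      unfolding distrib_right by (intro add_mono mult_left_mono) auto
    finally have le: "h / 2 * min 1 (\<Lambda> x) \<le> (hellinger (est x) q\<^sub>0)\<^sup>2 + \<Lambda> x * (hellinger (est x) q\<^sub>1)\<^sup>2"
      by (simp add: mult.commute)
    have "ennreal (h / 2) * ennreal (min 1 (\<Lambda> x)) = ennreal (h / 2 * min 1 (\<Lambda> x))"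
      using \<Lambda>0[of x] by (intro ennreal_mult[symmetric]) (auto simp: h_def)
    also have "\<dots> \<le> ennreal ((hellinger (est x) q\<^sub>0)\<^sup>2 + \<Lambda> x * (hellinger (est x) q\<^sub>1)\<^sup>2)"
      by (rule ennreal_leI[OF le])
    also have "\<dots> = ennreal ((hellinger (est x) q\<^sub>0)\<^sup>2) + ennreal (\<Lambda> x) * ennreal ((hellinger (est x) q\<^sub>1)\<^sup>2)"
      using \<Lambda>0[of x] by (simp add: ennreal_mult ennreal_plus)
    finally show "ennreal (h / 2) * ennreal (min 1 (\<Lambda> x)) \<le>
        ennreal ((hellinger (est x) q\<^sub>0)\<^sup>2) + ennreal (\<Lambda> x) * ennreal ((hellinger (est x) q\<^sub>1)\<^sup>2)" .
  qed
  also have "\<dots> = risk n est q\<^sub>0 + risk n est q\<^sub>1"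
    unfolding risk_def law0 law1 by (subst nn_integral_add) (auto simp: nn_integral_density)
  finally show ?thesis by (simp add: q\<^sub>0_def q\<^sub>1_def)
qed

text \<open>The condition on \<open>n\<close> puts \<open>1 / sqrt n\<close> into the range of
  admissible means. The larger of the two risks is at least half their sum, which halves
  \<open>3 / 256\<close>.\<close>

lemma minimax_risk_lower_bound:
  assumes b: "0 \<le> b" and n: "0 < n" and bn: "1 \<le> b\<^sup>2 * real n"
  shows "ennreal ((3 / 512) / real n) \<le> minimax_risk b p n"
  unfolding minimax_risk_def
proof (rule INF_greatest)
  fix est assume "est \<in> {est. estimator n est}"
  then have est: "estimator n est" by simp
  define \<delta> where "\<delta> = 1 / sqrt (real n)"
  have \<delta>: "\<delta>\<^sup>2 = 1 / real n" by (simp add: \<delta>_def power_divide)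
  have \<delta>0: "0 \<le> \<delta>" by (simp add: \<delta>_def)
  have "\<delta>\<^sup>2 \<le> b\<^sup>2" unfolding \<delta> using bn n by (simp add: field_simps)
  then have \<delta>b: "\<delta> \<le> b" using b by (rule power2_le_imp_le)
  let ?r = "ennreal ((3 / 512) / real n)"
  have "normal_density 0 1 \<in> full_model b p" "normal_density \<delta> 1 \<in> full_model b p"
    unfolding full_model_def model1_def using b \<delta>0 \<delta>b by auto
  then have "risk n est (normal_density 0 1) \<le> max_risk b p n est"
      "risk n est (normal_density \<delta> 1) \<le> max_risk b p n est"
    unfolding max_risk_def by (auto intro: SUP_upper)
  then have "risk n est (normal_density 0 1) + risk n est (normal_density \<delta> 1)
      \<le> max_risk b p n est + max_risk b p n est"
    by (rule add_mono)
  moreover have "?r + ?r = ennreal (3 / (256 * real n))"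
    by (simp flip: ennreal_plus)
  ultimately have *: "?r + ?r \<le> max_risk b p n est + max_risk b p n est"
    using two_point_risk_bound[OF est n \<delta>] by simp
  show "?r \<le> max_risk b p n est"
  proof (rule ccontr)
    assume "\<not> ?r \<le> max_risk b p n est"
    then have "max_risk b p n est + max_risk b p n est < ?r + ?r"
      by (intro add_strict_mono) auto
    with * show False by simp
  qed
qed

theorem proposition17:
  fixes b p :: real
  assumes "0 < b" and "0 < p" and "p < 1 / 2"
  shows "\<forall>\<^sub>F a :: real in at_top. \<exists>c C :: real. 0 < c \<and> c < C \<and>
    (\<forall>\<^sub>F n :: nat in sequentially.
       ennreal (c / real n) \<le> minimax_risk b p n \<and>
       (\<forall>fhat. (\<forall>k \<in> {1, 2}. is_mle b p n k (fhat k)) \<longrightarrow>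
          minimax_risk b p n \<le> max_risk b p n (aic_estimator a n fhat) \<and>
          max_risk b p n (aic_estimator a n fhat) \<le> ennreal (C / real n)))"
proof (rule eventually_mono[OF eventually_ge_at_top[of 0]])
  fix a :: real assume a: "0 \<le> a"
  have p: "0 \<le> p" "p \<le> 1" "p \<le> 1 / 2" and b: "0 \<le> b" using assms by auto
  obtain C where C: "0 \<le> C" and upper: "\<And>n est f. 0 < n \<Longrightarrow> f \<in> normal_mixtures b \<Longrightarrow>
      (\<And>x. x \<in> space (sample_space n) \<Longrightarrow> est x \<in> normal_mixtures b) \<Longrightarrow>
      (\<And>x. x \<in> space (sample_space n) \<Longrightarrow>
        (\<Sum>i = 1..n. ln (f (x i))) \<le> (\<Sum>i = 1..n. ln (est x (x i))) + 3 * a) \<Longrightarrow>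
      risk n est f \<le> ennreal (C / real n)"
    using approximate_mle_risk[OF b, of "3 * a"] a by auto
  \<comment> \<open>From here on \<open>1 / sqrt n \<le> b\<close>; the maximum with
    \<open>1\<close> secures \<open>0 < n\<close>.\<close>
  define N where "N = max 1 (nat \<lceil>1 / b\<^sup>2\<rceil>)"
  show "\<exists>c C :: real. 0 < c \<and> c < C \<and>
    (\<forall>\<^sub>F n :: nat in sequentially.
       ennreal (c / real n) \<le> minimax_risk b p n \<and>
       (\<forall>fhat. (\<forall>k \<in> {1, 2}. is_mle b p n k (fhat k)) \<longrightarrow>
          minimax_risk b p n \<le> max_risk b p n (aic_estimator a n fhat) \<and>
          max_risk b p n (aic_estimator a n fhat) \<le> ennreal (C / real n)))"
  \<comment> \<open>\<open>C\<close> may be zero, so \<open>C + 1\<close> is taken to make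
    \<open>c < C\<close> strict.\<close>
  proof (rule exI[of _ "3 / 512"], rule exI[of _ "C + 1"], intro conjI
      eventually_mono[OF eventually_ge_at_top[of N]] allI impI)
    show "(0 :: real) < 3 / 512" "3 / 512 < C + 1" using C by auto
    fix n assume nN: "N \<le> n"
    then have n: "0 < n" by (simp add: N_def)
    have "1 / b\<^sup>2 \<le> real n" using nN by (simp add: N_def ceiling_le_iff nat_le_iff)
    then have "1 \<le> b\<^sup>2 * real n" using assms(1) by (simp add: field_simps)
    then show "ennreal (3 / 512 / real n) \<le> minimax_risk b p n"
      by (rule minimax_risk_lower_bound[OF b n])
    fix fhat assume "\<forall>k \<in> {1, 2}. is_mle b p n k (fhat k)"
    then have mle: "\<And>k. k \<in> {1, 2} \<Longrightarrow> is_mle b p n k (fhat k)" by blast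
    have "estimator n (aic_estimator a n fhat)"
      by (rule aic_estimator_is_estimator[OF mle p(1,3) b a n])
    then show "minimax_risk b p n \<le> max_risk b p n (aic_estimator a n fhat)"
      unfolding minimax_risk_def by (intro INF_lower) simp
    show "max_risk b p n (aic_estimator a n fhat) \<le> ennreal ((C + 1) / real n)"
      unfolding max_risk_def
    proof (rule SUP_least)
      fix f assume f: "f \<in> full_model b p"
      have "risk n (aic_estimator a n fhat) f \<le> ennreal (C / real n)"
        using full_model_subset[OF p(1,2), of b] aic_estimator_loglik[OF mle _ f p(3) a n] f
        by (intro upper[OF n]) auto
      also have "\<dots> \<le> ennreal ((C + 1) / real n)"
        by (intro ennreal_leI divide_right_mono) auto
      finally show "risk n (aic_estimator a n fhat) f \<le> ennreal ((C + 1) / real n)" .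
    qed
  qed
qed

end
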